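(* For any odd integers $k \geq 3$ and $\ell > 5$, the edges of the bumpy wheel $BW_{k,\ell}$ cannot be partitioned into $n = \frac{k\ell+1}{2}$ plane subgraphs.
   Context: A geometric graph is a graph drawn in the plane whose vertices are points in general position and whose edges are straight-line segments; it is plane if no two edges share a point of their relative interiors. A partition of a graph into subgraphs is a set of edge-disjoint subgraphs whose union is the graph. For odd integers $k,\ell\ge 3$, the bumpy wheel $BW_{k,\ell}$ is the complete geometric graph on the following set of $k\ell+1$ points: take a regular $k$-gon with center $v_0$ and replace each of its $k$ vertices by a group of $\ell$ points that are $\varepsilon$-close for a sufficiently small $\varepsilon>0$, such that all $k\ell$ points other than $v_0$ lie on the convex hull (in convex position), $v_0$ is the only interior point, and the convex hull of any $\frac{k+1}{2}$ consecutive groups does not contain $v_0$. *)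

theory Defs
  imports "HOL-Analysis.Analysis"
begin

text \<open>The plane is the type \<^typ>\<open>complex\<close>. An edge is the two-element set of its endpoints, so the
  segment drawn for an edge \<open>e\<close> is \<open>convex hull e\<close>.\<close>

record 'a sgraph =
  verts :: "'a set"
  edges :: "'a set set"

definition all_edges :: "'a set \<Rightarrow> 'a set set" where
  "all_edges V = {e. e \<subseteq> V \<and> card e = 2}"

definition complete_graph :: "'a set \<Rightarrow> 'a sgraph" where
  "complete_graph V = \<lparr>verts = V, edges = all_edges V\<rparr>"

definition subgraph :: "'a sgraph \<Rightarrow> 'a sgraph \<Rightarrow> bool" where
  "subgraph H G \<longleftrightarrow>
     verts H \<subseteq> verts G \<and> edges H \<subseteq> edges G \<and> edges H \<subseteq> all_edges (verts H)"

text \<open>Only edges have to be disjoint; the members may share vertices.\<close>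

definition graph_partition :: "'a sgraph set \<Rightarrow> 'a sgraph \<Rightarrow> bool" where
  "graph_partition P G \<longleftrightarrow>
     (\<forall>H\<in>P. subgraph H G) \<and>
     disjoint_family_on edges P \<and>
     (\<Union>H\<in>P. verts H) = verts G \<and>
     (\<Union>H\<in>P. edges H) = edges G"

definition general_position :: "complex set \<Rightarrow> bool" where
  "general_position V \<longleftrightarrow> (\<forall>T\<subseteq>V. card T = 3 \<longrightarrow> \<not> collinear T)"

definition geometric_graph :: "complex sgraph \<Rightarrow> bool" where
  "geometric_graph G \<longleftrightarrow>
     finite (verts G) \<and> general_position (verts G) \<and> edges G \<subseteq> all_edges (verts G)"

definition plane_graph :: "complex sgraph \<Rightarrow> bool" where
  "plane_graph G \<longleftrightarrow>
     geometric_graph G \<and>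
     pairwise (\<lambda>e f. rel_interior (convex hull e) \<inter> rel_interior (convex hull f) = {}) (edges G)"

definition polygon_vertex :: "nat \<Rightarrow> complex \<Rightarrow> real \<Rightarrow> real \<Rightarrow> nat \<Rightarrow> complex" where
  "polygon_vertex k c r \<theta> i = c + of_real r * cis (\<theta> + 2 * pi * real i / real k)"

text \<open>\<open>bumpy_wheel k l v\<^sub>0 r \<theta> \<epsilon> G\<close>: the geometric graph \<open>G\<close> is a bumpy wheel obtained from the regular
  \<open>k\<close>-gon with centre \<open>v\<^sub>0\<close>, circumradius \<open>r\<close> and rotation angle \<open>\<theta>\<close>, where \<open>A i\<close> is the group of \<open>l\<close>
  points replacing the \<open>i\<close>-th vertex. How small \<open>\<epsilon>\<close> has to be is left to the user of the predicate.\<close>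

definition bumpy_wheel ::
  "nat \<Rightarrow> nat \<Rightarrow> complex \<Rightarrow> real \<Rightarrow> real \<Rightarrow> real \<Rightarrow> complex sgraph \<Rightarrow> bool" where
  "bumpy_wheel k l v\<^sub>0 r \<theta> \<epsilon> G \<longleftrightarrow>
     (\<exists>A :: nat \<Rightarrow> complex set.
        let W = (\<Union>i<k. A i); V = insert v\<^sub>0 W in
          (\<forall>i<k. card (A i) = l \<and> A i \<subseteq> ball (polygon_vertex k v\<^sub>0 r \<theta> i) \<epsilon>) \<and>
          disjoint_family_on A {..<k} \<and>
          (\<forall>p\<in>W. p extreme_point_of (convex hull V)) \<and>
          V \<inter> interior (convex hull V) = {v\<^sub>0} \<and>
          (\<forall>i<k. v\<^sub>0 \<notin> convex hull (\<Union>j<(k + 1) div 2. A ((i + j) mod k))) \<and>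
          G = complete_graph V \<and>
          geometric_graph G)"

end

theory Submission
  imports Defs
begin

text \<open>Let \<open>k = 2m + 1\<close> and call two groups opposite if they are \<open>m\<close> steps apart. Two chords joining opposite groups
  cross unless they involve at most three groups in total, so (apart from triangles when \<open>k = 3\<close>) each plane
  class has its long chords between one middle group and its two opposite groups. Among the chords of
  hull distance at least \<open>m l\<close> a class contains at most \<open>l + 1\<close>, and on average there are \<open>l + 1 - (l + 1) / (2n)\<close>,
  so almost all classes are full. Counting the chords of hull distance exactly \<open>m l\<close> shows that all classes but
  one have a middle group; the remaining class leaves \<open>m\<close> groups visible from the centre, and in the other
  \<open>m + 1\<close> groups there are exactly \<open>(l - 1) / 2\<close> classes per middle group. A class with a middle group traps the
  centre so that each missing long chord pays for one further radial edge to a point that is not first or last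
  in its group. Hence the \<open>(m + 1) (l - 2)\<close> such radial edges at those \<open>m + 1\<close> groups give
  \<open>(m + 1) (l - 3) \<le> l - 1\<close>, which fails for \<open>l > 5\<close>.\<close>

section \<open>Colourings of the long chords and radial edges\<close>

text \<open>With \<open>k = 2m + 1\<close>, group \<open>i\<close> is here the \<open>(i m mod k)\<close>-th group of the wheel, so that consecutive groups are
  almost opposite. \<open>col i a b\<close> is the colour of the chord from the \<open>a\<close>-th point of group \<open>i\<close> to the \<open>b\<close>-th point
  of group \<open>i + 1\<close>, \<open>rad i p\<close> that of the radial edge to the \<open>p\<close>-th point of group \<open>i\<close>. Each of the last six
  assumptions records a crossing.\<close>

locale star_colouring =
  fixes m l :: nat and col :: "nat \<Rightarrow> nat \<Rightarrow> nat \<Rightarrow> 'c" and rad :: "nat \<Rightarrow> nat \<Rightarrow> 'c" and P :: "'c set"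
  assumes m_pos: "1 \<le> m" and l_gt: "l > 5"
    and finite_P: "finite P" and card_P: "2 * card P = (2 * m + 1) * l + 1"
    and col_in: "\<And>i a b. a < l \<Longrightarrow> b < l \<Longrightarrow> col i a b \<in> P"
    and rad_in: "\<And>i p. p < l \<Longrightarrow> rad i p \<in> P"
    and col_periodic: "\<And>i. col (i + (2 * m + 1)) = col i"
    and rad_periodic: "\<And>i. rad (i + (2 * m + 1)) = rad i"
    and far: "\<And>i d a b a' b'. \<lbrakk>2 \<le> d; d < 2 * m; a < l; b < l; a' < l; b' < l\<rbrakk>
                \<Longrightarrow> col i a b \<noteq> col (i + d) a' b'"
    and parallel: "\<And>i a b a' b'. \<lbrakk>a < a'; b < b'; a' < l; b' < l\<rbrakk> \<Longrightarrow> col i a b \<noteq> col i a' b'"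
    and adjacent: "\<And>i a b a' b'. \<lbrakk>col i a b = col (i + 1) a' b'; a < l; b < l; a' < l; b' < l\<rbrakk> \<Longrightarrow> b \<le> a'"
    and rad_start: "\<And>i a b p. \<lbrakk>rad i p = col i a b; a < l; b < l; p < l\<rbrakk> \<Longrightarrow> p \<le> a"
    and rad_end: "\<And>i a b p. \<lbrakk>rad (i + 1) p = col i a b; a < l; b < l; p < l\<rbrakk> \<Longrightarrow> b \<le> p"
    and rad_far: "\<And>i a b p s. \<lbrakk>1 \<le> s; s < m; a < l; b < l; p < l\<rbrakk> \<Longrightarrow> rad (i + 1 + 2 * s) p \<noteq> col i a b"
begin

section \<open>Long chords of a single colour in the star order\<close>

abbreviation k where "k \<equiv> 2 * m + 1"

abbreviation nxt where "nxt i \<equiv> (i + 1) mod k"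

lemma col_mod: "col (i mod k) = col i"
proof -
  have "col (j + n * k) = col j" for j n
    by (induction n) (use col_periodic[of "j + n * k" for n] in \<open>simp_all add: algebra_simps\<close>)
  from this[of "i mod k" "i div k"] show ?thesis by (simp only: mod_div_mult_eq)
qed

lemmas col_mods = col_mod col_mod[simplified]

lemma rad_mod: "rad (i mod k) = rad i"
proof -
  have "rad (j + n * k) = rad j" for j n
    by (induction n) (use rad_periodic[of "j + n * k" for n] in \<open>simp_all add: algebra_simps\<close>)
  from this[of "i mod k" "i div k"] show ?thesis by (simp only: mod_div_mult_eq)
qed

text \<open>The number of points cut off by a chord \<open>(a, b)\<close> grows with \<open>b - a\<close>, and the chords with \<open>a \<le> b\<close> are
  exactly those of hull distance at least \<open>m l\<close>. For a fixed colour and a fixed pair of groups the differences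
  \<open>b - a\<close> are distinct.\<close>

definition D :: "'c \<Rightarrow> nat \<Rightarrow> (nat \<times> nat) set" where
  "D c i = {(a, b). a \<le> b \<and> b < l \<and> col i a b = c}"

definition supp :: "'c \<Rightarrow> nat set" where
  "supp c = {i. i < k \<and> D c i \<noteq> {}}"

definition Z :: "'c \<Rightarrow> nat set" where
  "Z c = {i. i < k \<and> (\<exists>a<l. col i a a = c)}"

definition f :: "'c \<Rightarrow> nat" where
  "f c = (\<Sum>i<k. card (D c i))"

lemma finite_D: "finite (D c i)"
  by (rule finite_subset[of _ "{..<l} \<times> {..<l}"]) (auto simp: D_def)

lemma Z_subset_supp: "Z c \<subseteq> supp c"
  by (auto simp: Z_def supp_def D_def)

lemma f_eq: "f c = (\<Sum>i\<in>supp c. card (D c i))"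
  unfolding f_def by (rule sum.mono_neutral_right) (auto simp: supp_def)

text \<open>One chord of greatest width \<open>T\<close> stands for all of \<open>D c i\<close>. The
  widths are distinct numbers up to \<open>T\<close>, and width 0 occurs only if
  \<open>i mod k\<close> is in \<open>Z c\<close>, which otherwise saves one.\<close>

lemma D_widest:
  assumes "D c i \<noteq> {}"
  obtains a T where "a + T < l" "col i a (a + T) = c" "card (D c i) \<le> T + 1"
    "i mod k \<notin> Z c \<Longrightarrow> card (D c i) \<le> T"
    "\<And>a' b'. (a', b') \<in> D c i \<Longrightarrow> b' - a' \<le> T"
proof -
  let ?w = "\<lambda>(a, b). b - a"
  define T where "T = Max (?w ` D c i)"
  have fin: "finite (?w ` D c i)" using finite_D by blast
  have "T \<in> ?w ` D c i" unfolding T_def using fin assms by (intro Max_in) auto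
  then obtain a b where ab: "(a, b) \<in> D c i" "T = b - a" by auto
  have le: "?w x \<le> T" if "x \<in> D c i" for x
    unfolding T_def using fin that by (intro Max_ge) auto
  have inj: "inj_on ?w (D c i)"
  proof (rule inj_onI, clarify)
    fix a b a' b' assume h: "(a, b) \<in> D c i" "(a', b') \<in> D c i" "b - a = b' - a'"
    then have "a \<le> b" "a' \<le> b'" "b < l" "b' < l" "col i a b = col i a' b'" by (auto simp: D_def)
    then have "\<not> (a < a' \<and> b < b')" "\<not> (a' < a \<and> b' < b)"
      using parallel[of a a' b b' i] parallel[of a' a b' b i] by auto
    then show "a = a' \<and> b = b'" using h(3) \<open>a \<le> b\<close> \<open>a' \<le> b'\<close> by linarith
  qed
  have c1: "card (D c i) \<le> T + 1"
    using card_mono[of "{..T}" "?w ` D c i"] card_image[OF inj] le by (simp add: image_subset_iff)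
  have c2: "card (D c i) \<le> T" if "i mod k \<notin> Z c"
  proof -
    have "?w ` D c i \<subseteq> {1..T}"
    proof (rule image_subsetI)
      fix x assume x: "x \<in> D c i"
      obtain a b where ab: "x = (a, b)" by (cases x)
      have "a \<noteq> b" "a \<le> b" using x that ab by (auto simp: D_def Z_def col_mods)
      then show "?w x \<in> {1..T}" using le[OF x] ab by auto
    qed
    then show ?thesis using card_mono[of "{1..T}" "?w ` D c i"] card_image[OF inj] by auto
  qed
  have "b = a + T" "b < l" "col i a b = c" using ab by (auto simp: D_def)
  then show ?thesis using that[of a T] c1 c2 le by auto
qed

text \<open>For \<open>i < j < k\<close>, being neither consecutive nor the pair \<open>0\<close>,
  \<open>2 * m\<close> puts \<open>j - i\<close> in the range covered by \<open>far\<close>.\<close>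

lemma supp_adjacent:
  assumes "i \<in> supp c" "j \<in> supp c" "i \<noteq> j"
  shows "j = nxt i \<or> i = nxt j"
proof -
  have main: "j = nxt i \<or> i = nxt j" if ij: "i < j" "i \<in> supp c" "j \<in> supp c" for i j
  proof (rule ccontr)
    assume n: "\<not> ?thesis"
    have lt: "j < k" using ij by (auto simp: supp_def)
    have "j \<noteq> i + 1" using n lt by auto
    moreover have "\<not> (i = 0 \<and> j = 2 * m)" using n by auto
    ultimately have d: "2 \<le> j - i" "j - i < 2 * m" using ij lt by auto
    obtain a b where "a \<le> b" "b < l" "col i a b = c" using ij(2) by (auto simp: supp_def D_def)
    moreover obtain a' b' where "a' \<le> b'" "b' < l" "col j a' b' = c"
      using ij(3) by (auto simp: supp_def D_def)
    ultimately show False using far[OF d, of a b a' b' i] ij(1) by auto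
  qed
  show ?thesis using main[of i j] main[of j i] assms by (meson linorder_neqE_nat)
qed

lemma D_adjacent:
  assumes "(a, b) \<in> D c i" "(a', b') \<in> D c (nxt i)"
  shows "b \<le> a'"
  using assms adjacent[of i a b a' b'] by (auto simp: D_def col_mods)

text \<open>Going once around the triangle, \<open>adjacent\<close> chains the endpoints to
  \<open>a + T \<le> a1 \<le> b1 \<le> a2 \<le> b2 \<le> a\<close>, so the greatest width
  \<open>T\<close> is 0.\<close>

lemma card_D_triple:
  assumes "i \<in> supp c" "nxt i \<in> supp c" "nxt (nxt i) \<in> supp c" "i = nxt (nxt (nxt i))"
  shows "card (D c i) \<le> 1"
proof -
  have "D c i \<noteq> {}" using assms by (simp add: supp_def)
  then obtain a T where T: "a + T < l" "col i a (a + T) = c" "card (D c i) \<le> T + 1"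
    by (rule D_widest)
  have 0: "(a, a + T) \<in> D c i" using T by (simp add: D_def)
  obtain a1 b1 where 1: "(a1, b1) \<in> D c (nxt i)" using assms by (auto simp: supp_def)
  obtain a2 b2 where 2: "(a2, b2) \<in> D c (nxt (nxt i))" using assms by (auto simp: supp_def)
  have "a + T \<le> a1" using D_adjacent[OF 0 1] .
  moreover have "b1 \<le> a2" using D_adjacent[OF 1 2] .
  moreover have "(a, a + T) \<in> D c (nxt (nxt (nxt i)))" unfolding assms(4)[symmetric] by (rule 0)
  then have "b2 \<le> a" by (rule D_adjacent[OF 2])
  moreover have "a1 \<le> b1" "a2 \<le> b2" using 1 2 by (auto simp: D_def)
  ultimately show ?thesis using T by linarith
qed

text \<open>Three nonempty pairs are possible only for \<open>k = 3\<close>, and then the chords form a triangle.\<close>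

lemma supp_cases:
  obtains (small) i where "i < k" "supp c \<subseteq> {i, nxt i}" | (triple) "f c \<le> 3"
proof (cases "\<exists>i\<in>supp c. nxt i \<in> supp c \<and> (\<exists>h\<in>supp c. h \<noteq> i \<and> h \<noteq> nxt i)")
  case True
  then obtain i h where ih: "i \<in> supp c" "nxt i \<in> supp c" "h \<in> supp c" "h \<noteq> i" "h \<noteq> nxt i" by blast
  \<comment> \<open>A further member of \<open>supp c\<close> is adjacent to both \<open>i\<close>
    and \<open>nxt i\<close>, which closes a cycle of length three.\<close>
  have third: "i = nxt x \<and> x = nxt (nxt i)" if x: "x \<in> supp c" "x \<noteq> i" "x \<noteq> nxt i" for x
  proof -
    have a: "i = nxt x" using supp_adjacent[OF ih(1) x(1)] x by auto
    have "nxt i \<noteq> i"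
    proof
      assume "nxt i = i"
      moreover have "i < k" using ih by (simp add: supp_def)
      ultimately show False using m_pos by (cases "i + 1 = k") auto
    qed
    then show ?thesis using a supp_adjacent[OF ih(2) x(1)] x by metis
  qed
  have h: "h = nxt (nxt i)" using third[OF ih(3-5)] by (rule conjunct2)
  have e1: "i = nxt (nxt (nxt i))" using third[OF ih(3-5)] unfolding h by (rule conjunct1)
  have e2: "nxt (nxt i) \<in> supp c" using ih(3) unfolding h .
  have "x \<in> {i, nxt i, nxt (nxt i)}" if "x \<in> supp c" for x
    using third[OF that] by blast
  then have sup: "supp c = {i, nxt i, nxt (nxt i)}" using ih(1,2) e2 by blast
  have "card (D c i) \<le> 1" by (rule card_D_triple[OF ih(1,2) e2 e1])
  moreover have "card (D c (nxt i)) \<le> 1"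
    by (rule card_D_triple) (unfold e1[symmetric], (rule ih e2 refl)+)
  moreover have "card (D c (nxt (nxt i))) \<le> 1"
    by (rule card_D_triple) (unfold e1[symmetric], (rule ih e2 refl)+)
  ultimately have "\<forall>i\<in>supp c. card (D c i) \<le> 1" unfolding sup by blast
  then have "f c \<le> card (supp c)"
    using sum_bounded_above[of "supp c" "\<lambda>i. card (D c i)" 1] by (simp add: f_eq)
  also have "\<dots> \<le> 3" unfolding sup by (simp add: card_insert_if)
  finally show ?thesis by (rule triple)
next
  case False
  show ?thesis
  proof (cases "supp c = {}")
    case True then show ?thesis using small[of 0] by auto
  next
    case ne: False
    then obtain i where i: "i \<in> supp c" by auto
    show ?thesis
    proof (cases "supp c = {i}")
      case True then show ?thesis using small[of i] i by (auto simp: supp_def)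
    next
      case ne2: False
      then obtain j where j: "j \<in> supp c" "j \<noteq> i" using i by auto
      from supp_adjacent[OF i j(1)] j consider "j = nxt i" | "i = nxt j" by auto
      then show ?thesis
      proof cases
        case 1 then show ?thesis using False i j small[of i] by (auto simp: supp_def)
      next
        case 2 then show ?thesis using False i j small[of j] by (auto simp: supp_def)
      qed
    qed
  qed
qed

lemma nxt_neq: "i < k \<Longrightarrow> nxt i \<noteq> i"
  using m_pos by (cases "i + 1 = k") auto

lemma f_small:
  assumes "i < k" "supp c \<subseteq> {i, nxt i}"
  shows "f c = card (D c i) + card (D c (nxt i))"
proof -
  have "f c = (\<Sum>j\<in>{i, nxt i}. card (D c j))"
    unfolding f_def by (rule sum.mono_neutral_right) (use assms in \<open>auto simp: supp_def\<close>)
  then show ?thesis using nxt_neq[OF assms(1)] by simp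
qed

text \<open>Widest chords of two neighbouring pairs satisfy \<open>a + T \<le> a'\<close> and
  \<open>a' + T' < l\<close>, hence \<open>T + T' \<le> l - 1\<close>; width 0 adds one per
  pair.\<close>

lemma f_le: "f c \<le> l + 1"
proof (cases rule: supp_cases[of c])
  case (small i)
  note f = f_small[OF small]
  show ?thesis
  proof (cases "D c i = {}")
    case True
    show ?thesis
    proof (cases "D c (nxt i) = {}")
      case True then show ?thesis using \<open>D c i = {}\<close> f by simp
    next
      case False
      then obtain a T where "a + T < l" "card (D c (nxt i)) \<le> T + 1" by (rule D_widest)
      then show ?thesis using f True by simp
    qed
  next
    case False
    then obtain a T where 1: "a + T < l" "col i a (a + T) = c" "card (D c i) \<le> T + 1" by (rule D_widest)
    show ?thesis
    proof (cases "D c (nxt i) = {}")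
      case True then show ?thesis using f 1 by simp
    next
      case False
      then obtain a' T' where 2: "a' + T' < l" "col (nxt i) a' (a' + T') = c" "card (D c (nxt i)) \<le> T' + 1"
        by (rule D_widest)
      have "a + T \<le> a'" by (rule D_adjacent[of a _ c i _ "a' + T'"]) (use 1 2 in \<open>auto simp: D_def\<close>)
      then show ?thesis using 1 2 f by simp
    qed
  qed
next
  case triple then show ?thesis using l_gt by simp
qed

section \<open>Counting long chords over all colours\<close>

lemma card_fibres:
  assumes "finite A" "\<And>x. x \<in> A \<Longrightarrow> g x \<in> P"
  shows "(\<Sum>c\<in>P. card {x \<in> A. g x = c}) = card A"
  using sum.group[of A P g "\<lambda>_. 1::nat"] assms finite_P by auto

text \<open>The factor 2 clears the denominator of the triangular number
  \<open>l * (l + 1) / 2\<close> of long chords in each of the \<open>k\<close> pairs.\<close>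

lemma sum_f: "2 * (\<Sum>c\<in>P. f c) = k * (l * (l + 1))"
proof -
  have tri: "2 * card {(a, b). a \<le> b \<and> b < n} = n * (n + 1)" for n :: nat
  proof -
    have "{(a, b). a \<le> b \<and> b < n} = prod.swap ` (SIGMA b:{..<n}. {..b})" by (auto simp: image_iff)
    then have "card {(a, b). a \<le> b \<and> b < n} = (\<Sum>b<n. b + 1)"
      by (simp add: card_image)
    also have "2 * \<dots> = n * (n + 1)" by (induction n) auto
    finally show ?thesis .
  qed
  have fin: "finite {(a, b). a \<le> b \<and> b < l}"
    by (rule finite_subset[of _ "{..<l} \<times> {..<l}"]) auto
  have "(\<Sum>c\<in>P. card (D c i)) = card {(a, b). a \<le> b \<and> b < l}" for i
  proof -
    have "D c i = {x \<in> {(a, b). a \<le> b \<and> b < l}. (case x of (a, b) \<Rightarrow> col i a b) = c}" for c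
      by (auto simp: D_def)
    then show ?thesis using card_fibres[OF fin, of "\<lambda>(a, b). col i a b"] col_in by auto
  qed
  then have "(\<Sum>c\<in>P. f c) = k * card {(a, b). a \<le> b \<and> b < l}"
    unfolding f_def by (subst sum.swap) simp
  then show ?thesis by (simp only: tri[of l, symmetric] mult.left_commute[of 2 k])
qed

text \<open>A triangle is too wasteful: with \<open>f c \<le> 3\<close> and at most
  \<open>l + 1\<close> for every other colour, \<open>2 * card P - 2 = k * l - 1\<close> leaves
  \<open>l + 1 \<le> 6\<close>, against \<open>l > 5\<close>.\<close>

lemma supp_small:
  assumes "c \<in> P"
  obtains i where "i < k" "supp c \<subseteq> {i, nxt i}"
proof (cases rule: supp_cases[of c])
  case triple
  have "(\<Sum>c\<in>P. f c) = f c + (\<Sum>c\<in>P - {c}. f c)" by (rule sum.remove[OF finite_P assms])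
  also have "\<dots> \<le> 3 + card (P - {c}) * (l + 1)"
    using sum_bounded_above[of "P - {c}" f "l + 1"] f_le triple by auto
  finally have "(\<Sum>c\<in>P. f c) \<le> 3 + (card P - 1) * (l + 1)" using assms finite_P by simp
  then have "k * (l * (l + 1)) \<le> 6 + (2 * card P - 2) * (l + 1)" using sum_f by (simp add: algebra_simps)
  moreover have "2 * card P - 2 = k * l - 1" using card_P by simp
  ultimately have "(k * l) * (l + 1) \<le> 6 + (k * l - 1) * (l + 1)" by (simp only: mult.assoc)
  moreover have "(k * l) * (l + 1) = (k * l - 1) * (l + 1) + (l + 1)"
    using l_gt by (simp add: diff_mult_distrib)
  ultimately show ?thesis using l_gt by linarith
qed

lemma card_Z_le: "c \<in> P \<Longrightarrow> card (Z c) \<le> 2"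
proof -
  assume "c \<in> P"
  then obtain i where "i < k" "supp c \<subseteq> {i, nxt i}" by (rule supp_small)
  then have "card (Z c) \<le> card {i, nxt i}" using Z_subset_supp[of c] by (intro card_mono) auto
  also have "\<dots> \<le> 2" by (simp add: card_insert_if)
  finally show ?thesis .
qed

text \<open>By \<open>parallel\<close>, chords \<open>(a, a)\<close> and \<open>(b, b)\<close> of
  one pair with \<open>a \<noteq> b\<close> differ in colour, so \<open>card (Z c)\<close> counts
  these chords and not just the pairs containing them.\<close>

lemma sum_card_Z: "(\<Sum>c\<in>P. card (Z c)) = k * l"
proof -
  let ?A = "{..<k} \<times> {..<l}" and ?g = "\<lambda>(i, a). col i a a"
  have Zc: "card (Z c) = card {x \<in> ?A. ?g x = c}" for c
  proof -
    have "inj_on fst {x \<in> ?A. ?g x = c}"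
    proof (rule inj_onI, clarsimp)
      fix i a b assume "a < l" "b < l" "col i b b = col i a a" 
      then show "a = b" using parallel[of a b a b i] parallel[of b a b a i] by (metis linorder_neqE_nat)
    qed
    moreover have "fst ` {x \<in> ?A. ?g x = c} = Z c" by (force simp: Z_def)
    ultimately show ?thesis using card_image[of fst "{x \<in> ?A. ?g x = c}"] by simp
  qed
  have "(\<Sum>c\<in>P. card {x \<in> ?A. ?g x = c}) = card ?A"
    by (rule card_fibres) (use col_in in auto)
  then show ?thesis by (simp only: Zc card_cartesian_product card_lessThan)
qed

text \<open>The deficits \<open>2 - card (Z c)\<close> add up to
  \<open>2 * card P - k * l = 1\<close>.\<close>

lemma unique_deficient:
  obtains c0 where "c0 \<in> P" "card (Z c0) = 1" "\<And>c. c \<in> P \<Longrightarrow> c \<noteq> c0 \<Longrightarrow> card (Z c) = 2"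
proof -
  have "(\<Sum>c\<in>P. 2 - card (Z c)) = (\<Sum>c\<in>P. 2) - (\<Sum>c\<in>P. card (Z c))"
    using card_Z_le by (intro sum_subtractf_nat) auto
  also have "\<dots> = Suc 0" using card_P sum_card_Z by simp
  finally obtain c0 where c0: "c0 \<in> P" "2 - card (Z c0) = 1" "\<forall>c\<in>P. c0 \<noteq> c \<longrightarrow> 2 - card (Z c) = 0"
    using sum_eq_Suc0_iff[OF finite_P, of "\<lambda>c. 2 - card (Z c)"] by auto
  have "card (Z c) = 2" if "c \<in> P" "c \<noteq> c0" for c
    using card_Z_le[OF that(1)] c0(3) that by force
  moreover have "card (Z c0) = 1" using c0(2) by simp
  ultimately show ?thesis using that c0(1) by blast
qed

section \<open>Rotation, and the radial edges left to a colour\<close>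

text \<open>The assumptions are invariant under rotation, so the pair of the deficient colour can
  later be moved to index \<open>0\<close>.\<close>

lemma shift: "star_colouring m l (\<lambda>i. col (i + s)) (\<lambda>i. rad (i + s)) P"
proof (unfold_locales, goal_cases)
  case (7 i) then show ?case using col_periodic[of "i + s"] by (simp add: algebra_simps)
next
  case (8 i) then show ?case using rad_periodic[of "i + s"] by (simp add: algebra_simps)
next
  case (9 i d a b a' b') 
  from far[of d a b a' b' "i + s"] 9 show ?case by (auto simp: algebra_simps)
next
  case (10 i a b a' b') then show ?case using parallel by auto
next
  case (11 i a b a' b') then show ?case using adjacent[of "i + s"] by auto
next
  case (12 i a b p) then show ?case using rad_start[of "i + s"] by auto
next
  case (13 i a b p) then show ?case using rad_end[of "i + s"] by auto
next
  case (14 i a b p t) then show ?case using rad_far[of t a b p "i + s"] by (auto simp: algebra_simps)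
qed (use m_pos l_gt finite_P card_P col_in rad_in in auto)

text \<open>The groups whose points are counted. If the deficient colour has its chord between groups \<open>0\<close> and \<open>1\<close>, the
  groups outside \<open>H\<close> are the ones whose radial edges avoid that chord.\<close>

definition H :: "nat set" where
  "H = insert 0 ((\<lambda>s. 2 * s + 1) ` {..<m})"

text \<open>The first and last point of a group are dropped so that \<open>R c\<close> is empty for
  a colour with chords in two neighbouring pairs, one of them of width \<open>l - 1\<close>.\<close>

definition R :: "'c \<Rightarrow> (nat \<times> nat) set" where
  "R c = {(j, p). j \<in> H \<and> 1 \<le> p \<and> p \<le> l - 2 \<and> rad j p = c}"

lemma H_iff: "j \<in> H \<longleftrightarrow> j = 0 \<or> (odd j \<and> j < k)"
  by (auto simp: H_def elim!: oddE)

lemma card_H: "card H = m + 1"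
  by (simp add: H_def card_image inj_on_def image_iff)

lemma sum_R: "(\<Sum>c\<in>P. card (R c)) = (m + 1) * (l - 2)"
proof -
  let ?A = "H \<times> {1..l - 2}"
  have "R c = {x \<in> ?A. (case x of (j, p) \<Rightarrow> rad j p) = c}" for c by (auto simp: R_def)
  moreover have "finite ?A" by (simp add: H_def)
  ultimately show ?thesis
    using card_fibres[of ?A "\<lambda>(j, p). rad j p"] rad_in l_gt card_H by (fastforce simp: card_cartesian_product)
qed

text \<open>Write \<open>j\<close> as \<open>i + s\<close> modulo \<open>k\<close>. Through
  \<open>rad_far\<close>, the chord of pair \<open>i\<close> excludes odd \<open>s \<ge> 3\<close>
  and the chord of pair \<open>nxt i\<close> excludes even \<open>s \<ge> 4\<close>; offsets 0, 1
  and 2 are limited by \<open>rad_start\<close> and \<open>rad_end\<close>.\<close>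

lemma R_double:
  assumes i: "i < k" and 1: "a + T < l" "col i a (a + T) = c" and 2: "e + T' < l" "col (nxt i) e (e + T') = c"
  assumes R: "(j, p) \<in> R c"
  shows "(j = i \<and> p \<le> a) \<or> (j = nxt i \<and> a + T \<le> p \<and> p \<le> e) \<or> (j = nxt (nxt i) \<and> e + T' \<le> p)"
proof -
  have j: "j < k" and p: "p < l" and r: "rad j p = c" using R l_gt by (auto simp: R_def H_iff)
  define s where "s = (if i \<le> j then j - i else j + k - i)"
  have s: "s < k" "j = (i + s) mod k"
  proof -
    show "s < k" using i j unfolding s_def by (split if_split) linarith
    have "i + s = j \<or> i + s = j + k" using i unfolding s_def by (split if_split) linarith
    then show "j = (i + s) mod k"
    proof
      assume "i + s = j" then show ?thesis using j by simp
    next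
      assume "i + s = j + k" then show ?thesis using j by (simp only: mod_add_self2 mod_less)
    qed
  qed
  have rs: "rad (i + s) p = c" using r unfolding s(2) rad_mod .
  have c2: "col (i + 1) e (e + T') = c" using 2(2) by (simp only: col_mod)
  have aT: "a < l" "e < l" using 1(1) 2(1) by simp_all
  have odd_far: False if "rad (h + 1 + 2 * t) p = col h x y" "1 \<le> t" "t < m" "x < l" "y < l" for h t x y
    using rad_far[of t x y p h] that p by blast
  consider "s = 0" | "s = 1" | "s = 2" | t where "s = 1 + 2 * t" "1 \<le> t" | t where "s = 2 + 2 * t" "1 \<le> t"
  proof (cases "even s")
    case True
    then obtain t where t: "s = 2 * t" by (elim evenE)
    show ?thesis
    proof (cases "t \<le> 1")
      case True then show ?thesis using t that(1,3) by (cases "t = 0") auto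
    next
      case False then show ?thesis using t that(5)[of "t - 1"] by simp
    qed
  next
    case False
    then obtain t where "s = 2 * t + 1" by (elim oddE)
    then show ?thesis using that(2) that(4)[of t] by (cases "t = 0") auto
  qed
  then show ?thesis
  proof cases
    case s0: 1
    then have "rad i p = col i a (a + T)" using rs 1(2) by simp
    then have "p \<le> a" using aT 1(1) p by (intro rad_start[of i p a "a + T"])
    moreover have "j = i" using s(2) s0 i by simp
    ultimately show ?thesis by blast
  next
    case s1: 2
    then have "rad (i + 1) p = col i a (a + T)" "rad (i + 1) p = col (i + 1) e (e + T')"
      using rs 1(2) c2 by simp_all
    then have "a + T \<le> p" "p \<le> e"
      using rad_end[of i p a "a + T"] rad_start[of "i + 1" p e "e + T'"] aT 1(1) 2(1) p by blast+
    moreover have "j = nxt i" using s(2) s1 by simp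
    ultimately show ?thesis by blast
  next
    case s2: 3
    then have "rad (i + 1 + 1) p = col (i + 1) e (e + T')" using rs c2 by simp
    then have "e + T' \<le> p" using rad_end[of "i + 1" p e "e + T'"] aT 2(1) p by blast
    moreover have "j = nxt (nxt i)" using s(2) s2 by (simp add: mod_simps)
    ultimately show ?thesis by blast
  next
    case (4 t)
    have "rad (i + 1 + 2 * t) p = col i a (a + T)" using rs 1(2) 4 by (simp add: add.assoc)
    moreover have "t < m" using 4 s(1) by simp
    ultimately show ?thesis using odd_far 4 aT 1(1) by blast
  next
    case (5 t)
    have "rad ((i + 1) + 1 + 2 * t) p = col (i + 1) e (e + T')" using rs c2 5 by (simp add: add.assoc)
    moreover have "t < m" using 5 s(1) by simp
    ultimately show ?thesis using odd_far 5 aT 2(1) by blast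
  qed
qed

text \<open>The three ranges of \<open>R_double\<close> contribute at most \<open>a\<close>,
  \<open>e + 1 - (a + T)\<close> and \<open>l - 1 - (e + T')\<close>, in total
  \<open>l - T - T'\<close>. For odd \<open>i\<close> the middle range drops out.\<close>

lemma card_R_double:
  assumes i: "i < k" and 1: "a + T < l" "col i a (a + T) = c" and 2: "e + T' < l" "col (nxt i) e (e + T') = c"
  shows "card (R c) + T + T' \<le> l" "odd i \<Longrightarrow> card (R c) + T + T' \<le> l - 1"
    "T = l - 1 \<or> T' = l - 1 \<Longrightarrow> R c = {}" "T + T' \<le> l - 1"
proof -
  note mem = R_double[OF assms]
  have ae: "a + T \<le> e"
    by (rule D_adjacent[of a _ c i _ "e + T'"]) (use assms in \<open>auto simp: D_def\<close>)
  then show "T + T' \<le> l - 1" using assms by simp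
  \<comment> \<open>Either equality pushes all chord endpoints to positions \<open>0\<close> or
    \<open>l - 1\<close>, so the only remaining \<open>p\<close> are the two that \<open>R\<close>
    excludes.\<close>
  show "R c = {}" if "T = l - 1 \<or> T' = l - 1"
  proof -
    have False if "(j, p) \<in> R c" for j p
      using mem[OF that] \<open>T = l - 1 \<or> T' = l - 1\<close> ae assms that by (auto simp: R_def)
    then show ?thesis by auto
  qed
  let ?X = "{i} \<times> {1..a}" and ?Y = "{nxt i} \<times> {a + T..e}" and ?W = "{nxt (nxt i)} \<times> {e + T'..l - 2}"
  have "R c \<subseteq> ?X \<union> ?Y \<union> ?W"
    using mem by (force simp: R_def)
  then have "card (R c) \<le> card (?X \<union> ?Y \<union> ?W)" by (intro card_mono) auto
  also have "\<dots> \<le> card ?X + card ?Y + card ?W"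
    by (meson add_right_mono card_Un_le order_trans)
  also have "\<dots> = a + (e + 1 - (a + T)) + (l - 1 - (e + T'))"
    using l_gt by (simp add: card_cartesian_product)
  finally show "card (R c) + T + T' \<le> l" using assms ae by linarith
  show "card (R c) + T + T' \<le> l - 1" if "odd i"
  proof -
    \<comment> \<open>An odd \<open>i\<close> is at most \<open>2 * m - 1\<close>, so the middle
      group is even and does not wrap around to \<open>0\<close>.\<close>
    have "i + 1 < k" using i that by (auto elim!: oddE)
    then have "nxt i \<notin> H" using that by (auto simp: H_iff)
    then have "R c \<subseteq> ?X \<union> ?W" using mem by (force simp: R_def)
    then have "card (R c) \<le> card (?X \<union> ?W)" by (intro card_mono) auto
    also have "\<dots> \<le> card ?X + card ?W" by (rule card_Un_le)
    also have "\<dots> = a + (l - 1 - (e + T'))"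
      using l_gt by (simp add: card_cartesian_product)
    finally show ?thesis using assms ae by linarith
  qed
qed

text \<open>\<open>H\<close> is chosen for this case: one chord of pair \<open>0\<close> blocks all
  odd groups from \<open>3\<close> on, and groups \<open>0\<close> and \<open>1\<close> keep at most
  \<open>a\<close> and \<open>l - 1 - (a + T)\<close> points.\<close>

lemma card_R_single:
  assumes "a + T < l" "col 0 a (a + T) = c"
  shows "card (R c) + T \<le> l - 1"
proof -
  have "R c \<subseteq> {0} \<times> {1..a} \<union> {1} \<times> {a + T..l - 2}"
  proof (rule subrelI)
    fix j p assume jp: "(j, p) \<in> R c"
    have p: "p < l" "1 \<le> p" "p \<le> l - 2" and r: "rad j p = c" and j: "j \<in> H" using jp l_gt by (auto simp: R_def)
    show "(j, p) \<in> {0} \<times> {1..a} \<union> {1} \<times> {a + T..l - 2}"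
    proof (cases "j = 0")
      case True then show ?thesis using rad_start[of 0 p a "a + T"] assms p r by auto
    next
      case False
      then obtain t where t: "j = 2 * t + 1" "j < k" using j by (auto simp: H_iff elim!: oddE)
      show ?thesis
      proof (cases "t = 0")
        case True then show ?thesis using rad_end[of 0 p a "a + T"] assms p r jp t by auto
      next
        case False then show ?thesis using rad_far[of t a "a + T" p 0] assms p r t by auto
      qed
    qed
  qed
  then have "card (R c) \<le> card ({0::nat} \<times> {1..a} \<union> {1} \<times> {a + T..l - 2})" by (intro card_mono) auto
  also have "\<dots> \<le> card ({0::nat} \<times> {1..a}) + card ({1::nat} \<times> {a + T..l - 2})" by (rule card_Un_le)
  also have "\<dots> = a + (l - 1 - (a + T))" using l_gt by (simp add: card_cartesian_product)
  finally show ?thesis using assms by linarith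
qed

end

section \<open>The deficient colour at pair \<open>0\<close> and the final count\<close>

locale star_colouring_at_0 = star_colouring m l col rad P
  for m l :: nat and col :: "nat \<Rightarrow> nat \<Rightarrow> nat \<Rightarrow> 'c" and rad :: "nat \<Rightarrow> nat \<Rightarrow> 'c" and P :: "'c set" +
  fixes c0 :: 'c
  assumes c0_in: "c0 \<in> P" and Z_c0: "Z c0 = {0}"
    and Z_other: "\<And>c. c \<in> P \<Longrightarrow> c \<noteq> c0 \<Longrightarrow> card (Z c) = 2"
begin

definition N :: "nat \<Rightarrow> nat" where
  "N i = card {c \<in> P - {c0}. Z c = {i, nxt i}}"

text \<open>Two elements of \<open>Z c\<close> already fill the two pairs that
  \<open>supp_small\<close> allows.\<close>

lemma other:
  assumes "c \<in> P" "c \<noteq> c0"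
  obtains i where "i < k" "Z c = {i, nxt i}" "supp c = {i, nxt i}"
proof -
  obtain i where i: "i < k" "supp c \<subseteq> {i, nxt i}" using supp_small assms by blast
  have "card {i, nxt i} = card (Z c)" using Z_other[OF assms] nxt_neq[OF i(1)] by simp
  moreover have "Z c \<subseteq> {i, nxt i}" using i Z_subset_supp by blast
  ultimately have "Z c = {i, nxt i}" by (intro card_subset_eq) auto
  then show ?thesis using that i Z_subset_supp[of c] by blast
qed

lemma nxt_inj: "i < k \<Longrightarrow> j < k \<Longrightarrow> nxt i = nxt j \<Longrightarrow> i = j"
  by (cases "i = 2 * m"; cases "j = 2 * m") auto

lemma nxt_nxt_neq: "i < k \<Longrightarrow> nxt (nxt i) \<noteq> i"
  using m_pos by (cases "i + 1 = k"; cases "i + 2 = k"; cases "i = 0") auto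

text \<open>The \<open>l\<close> chords \<open>(a, a)\<close> of pair \<open>nxt i\<close> have
  distinct colours. Each such colour other than \<open>c0\<close> also uses exactly one of the two
  neighbouring pairs; at pair \<open>0\<close> one chord belongs to \<open>c0\<close>.\<close>

lemma N_add:
  assumes "i < k"
  shows "N i + N (nxt i) = (if nxt i = 0 then l - 1 else l)"
proof -
  let ?j = "nxt i"
  let ?A = "{c \<in> P - {c0}. Z c = {i, ?j}}" and ?B = "{c \<in> P - {c0}. Z c = {?j, nxt ?j}}"
  let ?L = "(\<lambda>a. col ?j a a) ` {..<l}"
  have j: "?j < k" by simp
  have inj: "inj_on (\<lambda>a. col ?j a a) {..<l}"
  proof (rule inj_onI, clarsimp)
    fix a b assume h: "a < l" "b < l" "col (Suc i mod Suc (2 * m)) a a = col (Suc i mod Suc (2 * m)) b b"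
    then show "a = b" using parallel[of a b a b ?j] parallel[of b a b a ?j] by (metis Suc_eq_plus1 linorder_neqE_nat)
  qed
  have L: "?L = {c \<in> P. ?j \<in> Z c}" using col_in j by (auto simp: Z_def)
  have "?A \<union> ?B = {c \<in> P - {c0}. ?j \<in> Z c}"
  proof (intro set_eqI iffI)
    fix c assume c: "c \<in> {c \<in> P - {c0}. ?j \<in> Z c}"
    then have cc: "c \<in> P" "c \<noteq> c0" and jZ: "?j \<in> Z c" by blast+
    obtain h where h: "h < k" "Z c = {h, nxt h}" "supp c = {h, nxt h}" by (rule other[OF cc])
    have cP: "c \<in> P - {c0}" "?j \<in> {h, nxt h}" using c jZ unfolding h(2) by blast+
    from cP(2) consider "?j = h" | "i = h" using nxt_inj[OF assms h(1)] by blast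
    then show "c \<in> ?A \<union> ?B"
    proof cases
      case 1
      have "Z c = {?j, nxt ?j}" unfolding 1 by (rule h(2))
      then have "c \<in> ?B" using cP(1) by blast
      then show ?thesis ..
    next
      case 2
      have "Z c = {i, ?j}" unfolding 2 by (rule h(2))
      then have "c \<in> ?A" using cP(1) by blast
      then show ?thesis ..
    qed
  qed auto
  also have "\<dots> = ?L - {c0}" using L by auto
  finally have AB: "?A \<union> ?B = ?L - {c0}" .
  have "i \<notin> {?j, nxt ?j}" using nxt_neq[OF assms] nxt_nxt_neq[OF assms] by auto
  then have "?A \<inter> ?B = {}" by auto
  then have "N i + N ?j = card (?L - {c0})"
    unfolding N_def AB[symmetric] using finite_P by (intro card_Un_disjoint[symmetric]) auto
  also have "\<dots> = (if ?j = 0 then l - 1 else l)"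
  proof -
    have "c0 \<in> ?L \<longleftrightarrow> ?j = 0" using L c0_in Z_c0 by auto
    moreover have "card ?L = l" using card_image[OF inj] by simp
    ultimately show ?thesis by (auto simp: card_Diff_singleton_if)
  qed
  finally show ?thesis .
qed

text \<open>Comparing successive instances of \<open>N_add\<close> makes \<open>N\<close> constant
  on even indices; the instance that wraps around, \<open>N (2 * m) + N 0 = l - 1\<close>, fixes the
  value.\<close>

lemma N_even: "2 * j < k \<Longrightarrow> 2 * N (2 * j) = l - 1"
proof -
  have e: "N (2 * j) = N 0" if "2 * j < k" for j
    using that
  proof (induction j)
    case (Suc j)
    have "N (2 * j) + N (2 * j + 1) = l" "N (2 * j + 1) + N (2 * j + 2) = l"
      using N_add[of "2 * j"] N_add[of "2 * j + 1"] Suc.prems by auto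
    then show ?case using Suc by simp
  qed simp
  have "N (2 * m) + N 0 = l - 1" using N_add[of "2 * m"] by simp
  then show "2 * j < k \<Longrightarrow> 2 * N (2 * j) = l - 1" using e[of m] e[of j] by simp
qed

text \<open>The colours whose middle group \<open>i + 1\<close> lies in \<open>H\<close>; only they can contain \<open>l + 2\<close> counted edges.\<close>

definition E :: "'c set" where
  "E = {c \<in> P - {c0}. \<exists>i<k. even i \<and> Z c = {i, nxt i}}"

lemma base_unique:
  assumes "i < k" "j < k" "{i, nxt i} = {j, nxt j}"
  shows "i = j"
  using assms nxt_nxt_neq[OF assms(1)] by (metis doubleton_eq_iff)

lemma card_E: "2 * card E = (m + 1) * (l - 1)"
proof -
  have "E = (\<Union>j\<in>{..m}. {c \<in> P - {c0}. Z c = {2 * j, nxt (2 * j)}})"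
  proof (intro set_eqI iffI)
    fix c assume "c \<in> E"
    then obtain i where i: "c \<in> P - {c0}" "i < k" "even i" "Z c = {i, nxt i}" unfolding E_def by blast
    then obtain j where j: "i = 2 * j" by (elim evenE)
    then have "j \<in> {..m}" "c \<in> {c \<in> P - {c0}. Z c = {2 * j, nxt (2 * j)}}" using i by auto
    then show "c \<in> (\<Union>j\<in>{..m}. {c \<in> P - {c0}. Z c = {2 * j, nxt (2 * j)}})" by blast
  next
    fix c assume "c \<in> (\<Union>j\<in>{..m}. {c \<in> P - {c0}. Z c = {2 * j, nxt (2 * j)}})"
    then obtain j where j: "j \<le> m" "c \<in> P - {c0}" "Z c = {2 * j, nxt (2 * j)}" by blast
    have "2 * j < k" "even (2 * j)" using j(1) by simp_all
    then show "c \<in> E" unfolding E_def using j(2,3) by blast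
  qed
  also have "card \<dots> = (\<Sum>j\<le>m. N (2 * j))"
    unfolding N_def
  proof (rule card_UN_disjoint)
    show "\<forall>i\<in>{..m}. \<forall>j\<in>{..m}. i \<noteq> j \<longrightarrow> {c \<in> P - {c0}. Z c = {2 * i, nxt (2 * i)}} \<inter>
        {c \<in> P - {c0}. Z c = {2 * j, nxt (2 * j)}} = {}"
    proof (intro ballI impI, rule ccontr)
      fix i j assume h: "i \<in> {..m}" "j \<in> {..m}" "i \<noteq> j" "{c \<in> P - {c0}. Z c = {2 * i, nxt (2 * i)}} \<inter>
        {c \<in> P - {c0}. Z c = {2 * j, nxt (2 * j)}} \<noteq> {}"
      from h(4) obtain c where "Z c = {2 * i, nxt (2 * i)}" "Z c = {2 * j, nxt (2 * j)}" by blast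
      then have "{2 * i, nxt (2 * i)} = {2 * j, nxt (2 * j)}" by (rule subst)
      then have "2 * i = 2 * j" by (rule base_unique[rotated 2]) (use h in simp_all)
      then show False using h(3) by simp
    qed
  qed (use finite_P in auto)
  finally have "2 * card E = (\<Sum>j\<le>m. 2 * N (2 * j))" by (simp add: sum_distrib_left)
  also have "\<dots> = (\<Sum>j\<le>m. l - 1)" by (rule sum.cong) (simp_all add: N_even[simplified])
  finally show ?thesis by simp
qed

text \<open>\<open>T + T'\<close> raises the bound on \<open>f c\<close> and lowers the one on
  \<open>card (R c)\<close> equally, so it cancels in their sum.\<close>

lemma R_f_double:
  assumes "i < k" "supp c = {i, nxt i}"
  obtains T T' where "card (R c) + T + T' \<le> l" "odd i \<Longrightarrow> card (R c) + T + T' \<le> l - 1"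
    "T = l - 1 \<or> T' = l - 1 \<Longrightarrow> R c = {}" "T + T' \<le> l - 1"
    "f c \<le> T + T' + 2" "Z c \<noteq> {i, nxt i} \<Longrightarrow> f c \<le> T + T' + 1"
    "\<And>a' b'. (a', b') \<in> D c i \<Longrightarrow> b' - a' \<le> T"
    "\<And>a' b'. (a', b') \<in> D c (nxt i) \<Longrightarrow> b' - a' \<le> T'"
proof -
  have "i \<in> supp c" "nxt i \<in> supp c" unfolding assms(2) by blast+
  then have ne: "D c i \<noteq> {}" "D c (nxt i) \<noteq> {}" unfolding supp_def by blast+
  obtain a T where 1: "a + T < l" "col i a (a + T) = c" "card (D c i) \<le> T + 1"
    "i mod k \<notin> Z c \<Longrightarrow> card (D c i) \<le> T" "\<And>a' b'. (a', b') \<in> D c i \<Longrightarrow> b' - a' \<le> T"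
    by (rule D_widest[OF ne(1)]) blast
  obtain e T' where 2: "e + T' < l" "col (nxt i) e (e + T') = c" "card (D c (nxt i)) \<le> T' + 1"
    "nxt i mod k \<notin> Z c \<Longrightarrow> card (D c (nxt i)) \<le> T'" "\<And>a' b'. (a', b') \<in> D c (nxt i) \<Longrightarrow> b' - a' \<le> T'"
    by (rule D_widest[OF ne(2)]) blast
  have f: "f c = card (D c i) + card (D c (nxt i))" using f_small[of i c] assms by simp
  have "f c \<le> T + T' + 1" if "Z c \<noteq> {i, nxt i}"
  proof -
    have "i \<notin> Z c \<or> nxt i \<notin> Z c" using that Z_subset_supp[of c] assms by blast
    then show ?thesis using f 1(3,4) 2(3,4) assms(1) by auto
  qed
  then show ?thesis
    using that[of T T'] card_R_double[OF assms(1) 1(1,2) 2(1,2)] 1(3,5) 2(3,5) f by auto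
qed

text \<open>\<open>Z c0\<close> has one element, so if two pairs are occupied, \<open>f c0\<close>
  loses a unit; if only one is, the sum is at most \<open>l\<close> anyway.\<close>

lemma bound_c0: "card (R c0) + f c0 \<le> l + 1" "col 0 0 (l - 1) = c0 \<Longrightarrow> card (R c0) + f c0 \<le> l"
proof -
  have 0: "0 \<in> supp c0" using Z_c0 Z_subset_supp[of c0] by auto
  obtain i where i: "i < k" "supp c0 \<subseteq> {i, nxt i}" using supp_small c0_in by blast
  have *: "card (R c0) + f c0 \<le> l + 1 \<and> (col 0 0 (l - 1) = c0 \<longrightarrow> card (R c0) + f c0 \<le> l)"
  proof (cases "supp c0 = {0}")
    case True
    have "D c0 0 \<noteq> {}" using 0 by (auto simp: supp_def)
    then obtain a T where 1: "a + T < l" "col 0 a (a + T) = c0" "card (D c0 0) \<le> T + 1" by (rule D_widest)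
    have "f c0 = card (D c0 0)" using True by (simp add: f_eq)
    then show ?thesis using card_R_single[OF 1(1,2)] 1(1,3) by linarith
  next
    case False
    then obtain x where x: "x \<in> supp c0" "x \<noteq> 0" using 0 by blast
    have "x = i \<or> x = nxt i" "0 = i \<or> 0 = nxt i" using i(2) x(1) 0 by blast+
    then have "i \<in> supp c0" "nxt i \<in> supp c0" using x 0 by metis+
    then have s: "supp c0 = {i, nxt i}" using i(2) by blast
    obtain T T' where T: "card (R c0) + T + T' \<le> l"
      "T = l - 1 \<or> T' = l - 1 \<Longrightarrow> R c0 = {}" "T + T' \<le> l - 1" "Z c0 \<noteq> {i, nxt i} \<Longrightarrow> f c0 \<le> T + T' + 1"
      "\<And>a' b'. (a', b') \<in> D c0 i \<Longrightarrow> b' - a' \<le> T"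
      "\<And>a' b'. (a', b') \<in> D c0 (nxt i) \<Longrightarrow> b' - a' \<le> T'"
      by (rule R_f_double[OF i(1) s]) blast
    have f: "f c0 \<le> T + T' + 1" proof (rule T(4))
      show "Z c0 \<noteq> {i, nxt i}"
      proof
        assume "Z c0 = {i, nxt i}"
        then have "i \<in> {0}" "nxt i \<in> {0}" unfolding Z_c0 by (rule equalityD2[THEN subsetD], blast)+
        then show False using nxt_neq[OF i(1)] by (simp only: singleton_iff)
      qed
    qed
    moreover have "card (R c0) + f c0 \<le> l" if "col 0 0 (l - 1) = c0"
    proof -
      have "(0, l - 1) \<in> D c0 0" using that l_gt by (auto simp: D_def)
      moreover have "0 = i \<or> 0 = nxt i" using 0 unfolding s by blast
      ultimately have "l - 1 - 0 \<le> T \<or> l - 1 - 0 \<le> T'" using T(5,6) by metis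
      then have "T = l - 1 \<or> T' = l - 1" using T(3) by linarith
      then have "card (R c0) = 0" using T(2) by simp
      then show ?thesis using T(3) f l_gt by linarith
    qed
    ultimately show ?thesis using T(1) by auto
  qed
  then show "card (R c0) + f c0 \<le> l + 1" "col 0 0 (l - 1) = c0 \<Longrightarrow> card (R c0) + f c0 \<le> l" by auto
qed

lemma bound_other:
  assumes "c \<in> P" "c \<noteq> c0"
  shows "card (R c) + f c \<le> l + 1 + (if c \<in> E then 1 else 0)"
    "col 0 0 (l - 1) = c \<Longrightarrow> card (R c) + f c < l + 1 + (if c \<in> E then 1 else 0)"
proof -
  obtain i where i: "i < k" "Z c = {i, nxt i}" "supp c = {i, nxt i}" using other assms by blast
  have E: "c \<in> E \<longleftrightarrow> even i" using i assms base_unique[of i] by (auto simp: E_def)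
  obtain T T' where T: "card (R c) + T + T' \<le> l" "odd i \<Longrightarrow> card (R c) + T + T' \<le> l - 1"
      "T = l - 1 \<or> T' = l - 1 \<Longrightarrow> R c = {}" "T + T' \<le> l - 1" "f c \<le> T + T' + 2"
      "\<And>a' b'. (a', b') \<in> D c i \<Longrightarrow> b' - a' \<le> T"
      "\<And>a' b'. (a', b') \<in> D c (nxt i) \<Longrightarrow> b' - a' \<le> T'"
    by (rule R_f_double[OF i(1,3)]) blast
  show "card (R c) + f c \<le> l + 1 + (if c \<in> E then 1 else 0)"
    using T(1,2,5) E l_gt by auto
  show "card (R c) + f c < l + 1 + (if c \<in> E then 1 else 0)" if "col 0 0 (l - 1) = c"
  proof -
    have d: "(0, l - 1) \<in> D c 0" using that l_gt by (auto simp: D_def)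
    then have "0 \<in> supp c" by (auto simp: supp_def)
    then have z: "0 = i \<or> 0 = nxt i" using i by auto
    \<comment> \<open>If pair \<open>0\<close> comes second, then \<open>i = 2 * m\<close>, which is
      even too.\<close>
    then have "even i" using i(1) by (cases "i = 2 * m") auto
    moreover have "l - 1 - 0 \<le> T \<or> l - 1 - 0 \<le> T'" using T(6,7) d z by metis
    then have "T = l - 1 \<or> T' = l - 1" using T(4) by linarith
    then have "card (R c) = 0" using T(3) by simp
    ultimately show ?thesis using T(4,5) E l_gt by auto
  qed
qed

lemma contradiction: False
proof -
  let ?B = "\<lambda>c. l + 1 + (if c \<in> E then 1 else 0)"
  \<comment> \<open>Without the unit gained at this colour the count does not exclude \<open>k = 3\<close>, \<open>l = 7\<close>.\<close>
  let ?c1 = "col 0 0 (l - 1)"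
  have le: "card (R c) + f c \<le> ?B c" if "c \<in> P" for c
    using bound_c0(1) bound_other(1)[OF that] by (cases "c = c0") auto
  have c1: "?c1 \<in> P" using col_in l_gt by simp
  have lt: "card (R ?c1) + f ?c1 < ?B ?c1"
    using bound_c0(2) bound_other(2)[OF c1] by (cases "?c1 = c0") auto
  have "(\<Sum>c\<in>P. card (R c) + f c) < (\<Sum>c\<in>P. ?B c)"
  proof (rule sum_strict_mono_ex1)
    show "\<forall>c\<in>P. card (R c) + f c \<le> ?B c" using le by blast
    show "\<exists>c\<in>P. card (R c) + f c < ?B c" using c1 lt by blast
  qed (rule finite_P)
  also have "\<dots> = card P * (l + 1) + card E"
  proof -
    have "(\<Sum>c\<in>P. if c \<in> E then 1 else 0) = card E"
      using finite_P by (simp add: sum.If_cases E_def Int_def)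
    then show ?thesis by (simp only: sum.distrib sum_constant of_nat_id add_mult_distrib2)
  qed
  finally have "2 * ((m + 1) * (l - 2)) + k * (l * (l + 1)) + 2 \<le> 2 * card P * (l + 1) + 2 * card E"
    using sum_R sum_f by (simp add: sum.distrib)
  moreover have "2 * card P * (l + 1) = k * (l * (l + 1)) + (l + 1)" unfolding card_P by (simp add: algebra_simps)
  ultimately have "2 * ((m + 1) * (l - 2)) + 2 \<le> (l + 1) + (m + 1) * (l - 1)" using card_E by linarith
  \<comment> \<open>With \<open>l = q + 6\<close> the inequality becomes
    \<open>m * (q + 3) \<le> 2\<close>.\<close>
  moreover obtain q where q: "l = q + 6" using that[of "l - 6"] l_gt by simp
  ultimately have "2 * ((m + 1) * (q + 4)) + 2 \<le> q + 7 + (m + 1) * (q + 5)" by (simp add: add.commute)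
  then have "m * (q + 3) \<le> 2" by (simp add: algebra_simps)
  moreover have "1 * (q + 3) \<le> m * (q + 3)" using m_pos by (rule mult_right_mono) simp
  ultimately have "1 * (q + 3) \<le> 2" by (rule order_trans[rotated])
  then show False by simp
qed

end

lemma (in star_colouring) no_star_colouring: False
proof -
  obtain c0 where c0: "c0 \<in> P" "card (Z c0) = 1" by (rule unique_deficient)
  then obtain i0 where i0: "Z c0 = {i0}" by (auto simp: card_1_singleton_iff)
  interpret S: star_colouring m l "\<lambda>i. col (i + i0)" "\<lambda>i. rad (i + i0)" P by (rule shift)
  have "i0 < k" "\<exists>a<l. col i0 a a = c0" using i0 by (auto simp: Z_def)
  then have "0 \<in> S.Z c0" by (auto simp: S.Z_def)
  moreover have "i = 0" if "i \<in> S.Z c0" for i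
  proof -
    have "(i + i0) mod k \<in> Z c0" using that by (auto simp: S.Z_def Z_def col_mods)
    then have "(i + i0) mod k = i0" using i0 by simp
    moreover have "i < k" using that by (simp add: S.Z_def)
    ultimately show ?thesis using \<open>i0 < k\<close> by (cases "i + i0 < k") (simp_all add: mod_if[of "i + i0"])
  qed
  ultimately have Z0: "S.Z c0 = {0}" by auto
  obtain c' where c': "c' \<in> P" "card (S.Z c') = 1" "\<And>c. c \<in> P \<Longrightarrow> c \<noteq> c' \<Longrightarrow> card (S.Z c) = 2"
    by (rule S.unique_deficient) blast
  have "c' = c0" using c'(3)[OF c0(1)] Z0 by auto
  then interpret star_colouring_at_0 m l "\<lambda>i. col (i + i0)" "\<lambda>i. rad (i + i0)" P c0
    using c' Z0 by unfold_locales auto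
  show False by (rule contradiction)
qed

section \<open>Orientation and crossing segments\<close>

text \<open>Twice the signed area of the triangle, positive when \<open>x\<close>, \<open>y\<close>,
  \<open>z\<close> run counterclockwise.\<close>

definition orient :: "complex \<Rightarrow> complex \<Rightarrow> complex \<Rightarrow> real" where
  "orient x y z = Im (cnj (y - x) * (z - x))"

lemma orient_eq: "orient x y z = (Re y - Re x) * (Im z - Im x) - (Im y - Im x) * (Re z - Re x)"
  by (simp add: orient_def algebra_simps)

lemma orient_rotate: "orient y z x = orient x y z"
  by (simp add: orient_eq algebra_simps)

lemma orient_swap: "orient x z y = - orient x y z"
  by (simp add: orient_eq algebra_simps)

lemma orient_degenerate: "orient x x y = 0" "orient x y x = 0" "orient x y y = 0"
  by (simp_all add: orient_eq)

lemma orient_affine: "orient x y ((1 - t) *\<^sub>R u + t *\<^sub>R w) = (1 - t) * orient x y u + t * orient x y w"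
  by (simp add: orient_eq algebra_simps)

lemma orient_zero_on_line:
  assumes "orient x y z = 0" "x \<noteq> y"
  obtains s where "z = (1 - s) *\<^sub>R x + s *\<^sub>R y"
proof -
  have "Im ((z - x) / (y - x)) = 0"
    unfolding Im_complex_div_eq_0 using assms(1) by (simp add: orient_eq algebra_simps)
  then have "(z - x) / (y - x) = of_real (Re ((z - x) / (y - x)))" by (simp add: complex_eq_iff)
  then obtain s where "(z - x) / (y - x) = of_real s" by blast
  then have "z - x = s *\<^sub>R (y - x)" using assms(2) by (simp add: divide_eq_eq scaleR_conv_of_real)
  then have "z = (1 - s) *\<^sub>R x + s *\<^sub>R y" by (simp add: algebra_simps)
  then show ?thesis by (rule that)
qed

text \<open>Extremality is demanded of \<open>x\<close> and \<open>y\<close> alone because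
  \<open>u\<close> or \<open>w\<close> is the interior centre for radial edges. The segment from
  \<open>u\<close> to \<open>w\<close> meets the line through \<open>x\<close> and \<open>y\<close>
  inside the hull; were this beyond \<open>x\<close> or \<open>y\<close>, that point would not be
  extreme.\<close>

lemma open_segments_cross:
  assumes x: "x extreme_point_of (convex hull V)" and y: "y extreme_point_of (convex hull V)"
    and u: "u \<in> V" and w: "w \<in> V"
    and neg: "orient x y u < 0" and pos: "orient x y w > 0"
  shows "open_segment x y \<inter> open_segment u w \<noteq> {}"
proof -
  let ?C = "convex hull V"
  \<comment> \<open>The parameter at which the affine function \<open>orient x y\<close> vanishes
    between \<open>u\<close> and \<open>w\<close>.\<close>
  define t where "t = orient x y u / (orient x y u - orient x y w)"
  define z where "z = (1 - t) *\<^sub>R u + t *\<^sub>R w"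
  have t: "0 < t" "t < 1" using neg pos by (auto simp: t_def divide_simps)
  have uw: "u \<noteq> w" using neg pos by auto
  have z_uw: "z \<in> open_segment u w" using t uw by (auto simp: z_def in_segment)
  have uC: "u \<in> ?C" "w \<in> ?C" using u w by (auto simp: hull_inc)
  then have zC: "z \<in> ?C"
    using z_uw convex_contains_open_segment[of ?C] convex_convex_hull[of V] by auto
  have xy: "x \<noteq> y" using pos by (auto simp: orient_degenerate)
  have xyC: "x \<in> ?C" "y \<in> ?C" using x y by (auto simp: extreme_point_of_def)
  have nx: "x \<notin> open_segment a b" "y \<notin> open_segment a b" if "a \<in> ?C" "b \<in> ?C" for a b
    using x y that by (auto simp: extreme_point_of_def)
  have "orient x y z = 0"
    unfolding z_def orient_affine using neg pos by (simp add: t_def divide_simps)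
  then obtain s where s: "z = (1 - s) *\<^sub>R x + s *\<^sub>R y" using xy by (rule orient_zero_on_line)
  have "z \<noteq> x" "z \<noteq> y" using z_uw nx[OF uC] by blast+
  then have "s \<noteq> 0" "s \<noteq> 1" using s by auto
  moreover have "\<not> s < 0"
  proof
    assume "s < 0"
    have "x = (1 - (- s / (1 - s))) *\<^sub>R z + (- s / (1 - s)) *\<^sub>R y"
    proof -
      have "(1 - s) *\<^sub>R x = z - s *\<^sub>R y" using s by simp
      then have "(1 / (1 - s)) *\<^sub>R ((1 - s) *\<^sub>R x) = (1 / (1 - s)) *\<^sub>R (z - s *\<^sub>R y)" by simp
      moreover have "1 - (- s / (1 - s)) = 1 / (1 - s)" using \<open>s < 0\<close> by (simp add: field_simps)
      ultimately show ?thesis using \<open>s < 0\<close> by (simp add: scaleR_diff_right)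
    qed
    moreover have "0 < - s / (1 - s)" "- s / (1 - s) < 1" using \<open>s < 0\<close> by (auto simp: divide_simps)
    ultimately have "x \<in> open_segment z y" using \<open>z \<noteq> y\<close> unfolding in_segment by blast
    then show False using nx zC xyC by blast
  qed
  moreover have "\<not> s > 1"
  proof
    assume "s > 1"
    have "y = (1 - 1 / s) *\<^sub>R x + (1 / s) *\<^sub>R z"
    proof -
      have "s *\<^sub>R y = z - (1 - s) *\<^sub>R x" using s by simp
      then have "(1 / s) *\<^sub>R (s *\<^sub>R y) = (1 / s) *\<^sub>R (z - (1 - s) *\<^sub>R x)" by simp
      moreover have "1 - 1 / s = - ((1 - s) / s)" using \<open>s > 1\<close> by (simp add: field_simps)
      ultimately show ?thesis using \<open>s > 1\<close> by (simp add: scaleR_diff_right)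
    qed
    moreover have "0 < 1 / s" "1 / s < 1" using \<open>s > 1\<close> by auto
    ultimately have "y \<in> open_segment x z" using \<open>z \<noteq> x\<close> unfolding in_segment by blast
    then show False using nx zC xyC by blast
  qed
  ultimately have "0 < s" "s < 1" by auto
  then have "z \<in> open_segment x y" using s xy by (auto simp: in_segment)
  then show ?thesis using z_uw by blast
qed

text \<open>Otherwise \<open>y\<close> would lie in the triangle \<open>c x z\<close>.\<close>

lemma orient_extreme_between:
  assumes y: "y extreme_point_of (convex hull V)" and V: "c \<in> V" "x \<in> V" "z \<in> V"
    and xy: "orient c x y > 0" and yz: "orient c y z > 0" and xz: "orient c x z > 0"
  shows "orient x y z > 0"
proof (rule ccontr)
  assume "\<not> ?thesis"
  then have neg: "orient x y z \<le> 0" by simp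
  define d where "d = orient c x z"
  \<comment> \<open>The barycentric coordinates of \<open>y\<close> in the triangle
    \<open>c x z\<close>.\<close>
  define \<alpha> \<beta> \<gamma> where "\<alpha> = - orient x y z / d" and "\<beta> = orient c y z / d" and "\<gamma> = orient c x y / d"
  have d: "d > 0" using xz by (simp add: d_def)
  have sum1: "\<alpha> + \<beta> + \<gamma> = 1"
    using d by (simp add: \<alpha>_def \<beta>_def \<gamma>_def field_simps) (simp add: d_def orient_eq algebra_simps)
  have "d *\<^sub>R y = (- orient x y z) *\<^sub>R c + orient c y z *\<^sub>R x + orient c x y *\<^sub>R z"
    by (simp add: complex_eq_iff d_def orient_eq algebra_simps)
  then have "(1 / d) *\<^sub>R (d *\<^sub>R y) = \<alpha> *\<^sub>R c + \<beta> *\<^sub>R x + \<gamma> *\<^sub>R z"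
    by (simp only: scaleR_add_right \<alpha>_def \<beta>_def \<gamma>_def) simp
  then have eq: "y = \<alpha> *\<^sub>R c + \<beta> *\<^sub>R x + \<gamma> *\<^sub>R z" using d by simp
  have "\<alpha> \<ge> 0" "\<beta> \<ge> 0" "\<gamma> \<ge> 0" using d neg xy yz by (auto simp: \<alpha>_def \<beta>_def \<gamma>_def divide_simps)
  then have yT: "y \<in> convex hull {c, x, z}" unfolding convex_hull_3 using sum1 eq by blast
  have "convex hull {c, x, z} \<subseteq> convex hull V" using V by (intro hull_mono) auto
  then have "y extreme_point_of (convex hull {c, x, z})"
    using y yT by (auto simp: extreme_point_of_def)
  then have "y \<in> {c, x, z}" by (rule extreme_point_of_convex_hull)
  then show False using xy yz by (auto simp: orient_degenerate)
qed

section \<open>From oriented points to a star colouring\<close>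

text \<open>Distances are replaced by orientation signs. \<open>p g a\<close> is the
  \<open>a\<close>-th point of group \<open>g\<close>, counterclockwise around \<open>v0\<close>,
  with \<open>g\<close> read modulo \<open>2 * m + 1\<close>.\<close>

locale wheel =
  fixes m l :: nat and v0 :: complex and p :: "nat \<Rightarrow> nat \<Rightarrow> complex" and V :: "complex set"
  assumes m_pos: "1 \<le> m"
    and v0_in: "v0 \<in> V" and p_in: "\<And>g a. a < l \<Longrightarrow> p g a \<in> V"
    and p_extreme: "\<And>g a. a < l \<Longrightarrow> p g a extreme_point_of (convex hull V)"
    and p_periodic: "\<And>g. p (g + (2 * m + 1)) = p g"
    and same_group: "\<And>g a b. a < b \<Longrightarrow> b < l \<Longrightarrow> orient v0 (p g a) (p g b) > 0"
    and centre_left: "\<And>g s a b. \<lbrakk>1 \<le> s; s \<le> m; a < l; b < l\<rbrakk> \<Longrightarrow> orient v0 (p g a) (p (g + s) b) > 0"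
    and three_groups: "\<And>g s t a b c. \<lbrakk>1 \<le> s; s < t; t \<le> 2 * m; a < l; b < l; c < l\<rbrakk>
        \<Longrightarrow> orient (p g a) (p (g + s) b) (p (g + t) c) > 0"
begin

lemma p_add: "p (g + n * (2 * m + 1)) = p g"
proof (induction n)
  case (Suc n)
  have "g + Suc n * (2 * m + 1) = (g + n * (2 * m + 1)) + (2 * m + 1)" by (simp only: mult_Suc add_ac)
  then show ?case using Suc p_periodic by metis
qed simp

definition left :: "nat \<Rightarrow> nat \<Rightarrow> nat \<Rightarrow> complex set" where
  "left g a b = {z \<in> V. orient (p g a) (p (g + m) b) z > 0}"

definition right :: "nat \<Rightarrow> nat \<Rightarrow> nat \<Rightarrow> complex set" where
  "right g a b = {z \<in> V. orient (p g a) (p (g + m) b) z < 0}"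

lemma v0_left: "a < l \<Longrightarrow> b < l \<Longrightarrow> v0 \<in> left g a b"
  using centre_left[of m a b g] m_pos v0_in orient_rotate[of "p g a" "p (g + m) b" v0] by (simp add: left_def)

lemma left_later:
  assumes "a < l" "b < b'" "b' < l"
  shows "p (g + m) b' \<in> left g a b"
proof -
  have "orient (p g a) (p (g + m) b) (p (g + m) b') > 0"
    by (rule orient_extreme_between[OF p_extreme v0_in p_in p_in])
      (use assms m_pos in \<open>simp_all add: centre_left same_group\<close>)
  then show ?thesis using assms p_in by (simp add: left_def)
qed

lemma left_group: "\<lbrakk>m < s; s \<le> 2 * m; a < l; b < l; c < l\<rbrakk> \<Longrightarrow> p (g + s) c \<in> left g a b"
  using three_groups[of m s a b c g] m_pos p_in by (simp add: left_def)

lemma right_later: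
  assumes "a < a'" "a' < l" "b < l"
  shows "p g a' \<in> right g a b"
proof -
  have "orient (p g a) (p g a') (p (g + m) b) > 0"
    by (rule orient_extreme_between[OF p_extreme v0_in p_in p_in])
      (use assms m_pos in \<open>simp_all add: centre_left same_group\<close>)
  then show ?thesis
    using assms p_in orient_swap[of "p g a" "p (g + m) b" "p g a'"] by (simp add: right_def)
qed

lemma right_earlier:
  assumes "b' < b" "a < l" "b < l"
  shows "p (g + m) b' \<in> right g a b"
proof -
  have "orient (p g a) (p (g + m) b') (p (g + m) b) > 0"
    by (rule orient_extreme_between[OF p_extreme v0_in p_in p_in])
      (use assms m_pos in \<open>simp_all add: centre_left same_group\<close>)
  then show ?thesis
    using assms p_in orient_swap[of "p g a" "p (g + m) b" "p (g + m) b'"] by (simp add: right_def)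
qed

lemma right_group: "\<lbrakk>1 \<le> s; s < m; a < l; b < l; c < l\<rbrakk> \<Longrightarrow> p (g + s) c \<in> right g a b"
  using three_groups[of s m a c b g] m_pos p_in orient_swap[of "p g a" "p (g + m) b"]
  by (simp add: right_def)

text \<open>The class of an edge is its colour. Each crossing assumption of
  \<open>star_colouring\<close> follows from finding the ends of a segment on different sides of a
  chord. Star index \<open>i\<close> is group \<open>i * m\<close>, so two star steps go back one
  group, as \<open>2 * m\<close> is -1 modulo \<open>2 * m + 1\<close>.\<close>

lemma no_plane_partition:
  assumes "l > 5"
    and part: "graph_partition P (complete_graph V)" and card_P: "2 * card P = (2 * m + 1) * l + 1"
    and plane: "\<And>H. H \<in> P \<Longrightarrow> plane_graph H"
  shows False
proof -
  define colour where "colour e = (SOME H. H \<in> P \<and> e \<in> edges H)" for e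
  have colour: "colour e \<in> P \<and> e \<in> edges (colour e)" if "e \<in> all_edges V" for e
  proof -
    have "\<exists>H. H \<in> P \<and> e \<in> edges H"
      using part that by (auto simp: graph_partition_def complete_graph_def)
    then show ?thesis unfolding colour_def by (rule someI_ex)
  qed
  have edge: "{x, y} \<in> all_edges V" if "x \<in> V" "y \<in> V" "x \<noteq> y" for x y
    using that by (simp add: all_edges_def)
  have cross: "colour {p g a, p (g + m) b} \<noteq> colour {u, w}"
    if ab: "a < l" "b < l" and u: "u \<in> right g a b" and w: "w \<in> left g a b" for g a b u w
  proof
    let ?x = "p g a" and ?y = "p (g + m) b"
    assume same: "colour {?x, ?y} = colour {u, w}"
    have V: "u \<in> V" "w \<in> V" "orient ?x ?y u < 0" "orient ?x ?y w > 0"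
      using u w by (auto simp: left_def right_def)
    then have ne: "?x \<noteq> ?y" "u \<noteq> w" "{?x, ?y} \<noteq> {u, w}"
      by (auto simp: orient_degenerate doubleton_eq_iff)
    have e: "{?x, ?y} \<in> all_edges V" "{u, w} \<in> all_edges V" using edge p_in ab V ne by auto
    have "plane_graph (colour {u, w})" using plane colour[OF e(2)] by blast
    then have disj: "pairwise (\<lambda>e f. rel_interior (convex hull e) \<inter> rel_interior (convex hull f) = {})
        (edges (colour {u, w}))"
      by (simp add: plane_graph_def)
    have "{?x, ?y} \<in> edges (colour {u, w})" "{u, w} \<in> edges (colour {u, w})"
      using colour[OF e(1)] colour[OF e(2)] same by simp_all
    then have "rel_interior (convex hull {?x, ?y}) \<inter> rel_interior (convex hull {u, w}) = {}"
      by (rule pairwiseD[OF disj _ _ ne(3)])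
    then have "open_segment ?x ?y \<inter> open_segment u w = {}"
      using ne by (simp add: rel_interior_closed_segment flip: segment_convex_hull)
    then show False using open_segments_cross[OF p_extreme[OF ab(1)] p_extreme[OF ab(2)] V] by simp
  qed
  have cross': "colour {p g a, p (g + m) b} \<noteq> colour {w, u}"
    if "a < l" "b < l" "u \<in> right g a b" "w \<in> left g a b" for g a b u w
    using cross[OF that] by (simp add: insert_commute)
  define col where "col i a b = colour {p (i * m) a, p (i * m + m) b}" for i a b
  define rad where "rad i a = colour {v0, p (i * m) a}" for i a
  have fin: "finite P"
  proof (rule ccontr)
    assume "infinite P"
    \<comment> \<open>An infinite set has \<open>card\<close> 0 by convention, but
      \<open>card_P\<close> makes it positive.\<close>
    then have "card P = 0" by simp
    then show False using card_P by simp
  qed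
  interpret star_colouring m l col rad P
  proof
    fix i a b assume ab: "a < l" "b < l"
    have "p (i * m) a \<noteq> p (i * m + m) b"
      using centre_left[of m a b "i * m"] m_pos ab by (auto simp: orient_degenerate)
    then show "col i a b \<in> P" unfolding col_def by (rule colour[OF edge[OF p_in[OF ab(1)] p_in[OF ab(2)]], THEN conjunct1])
  next
    fix i a assume a: "a < l"
    have "v0 \<noteq> p (i * m) a"
      using centre_left[of m a a "i * m"] m_pos a by (auto simp: orient_degenerate)
    then show "rad i a \<in> P" unfolding rad_def by (rule colour[OF edge[OF v0_in p_in[OF a]], THEN conjunct1])
  next
    fix i
    have "(i + (2 * m + 1)) * m = i * m + m * (2 * m + 1)" "(i + (2 * m + 1)) * m + m = i * m + m + m * (2 * m + 1)"
      by (simp_all add: algebra_simps)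
    then have "p ((i + (2 * m + 1)) * m) = p (i * m)" "p ((i + (2 * m + 1)) * m + m) = p (i * m + m)"
      by (simp_all only: p_add)
    then show "col (i + (2 * m + 1)) = col i" "rad (i + (2 * m + 1)) = rad i"
      unfolding col_def rad_def by simp_all
  next
    fix i d a b a' b' assume d: "2 \<le> d" "d < 2 * m" and l: "a < l" "b < l" "a' < l" "b' < l"
    show "col i a b \<noteq> col (i + d) a' b'"
    proof (cases "even d")
      case True
      then obtain e' where e': "d = 2 * e'" by (elim evenE)
      then obtain e where "e' = Suc e" using d by (cases e') auto
      then have e: "d = 2 * (e + 1)" "e + 1 < m" using d e' by simp_all
      then obtain n where n: "m = e + 2 + n" using le_Suc_ex[of "e + 2" m] by auto
      \<comment> \<open>For even \<open>d\<close> the second chord starts left of the first and ends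
        right of it; for odd \<open>d\<close> below, it runs from right to left.\<close>
      have "(i + d) * m = i * m + (2 * m - e) + e * (2 * m + 1)"
        "(i + d) * m + m = i * m + (m - (e + 1)) + (e + 1) * (2 * m + 1)"
        by (simp_all add: e(1) n algebra_simps)
      then have "p ((i + d) * m) = p (i * m + (2 * m - e))"
        "p ((i + d) * m + m) = p (i * m + (m - (e + 1)))" by (simp_all only: p_add)
      then show ?thesis unfolding col_def
        using cross'[OF l(1,2) right_group[of "m - (e + 1)" a b b' "i * m"] left_group[of "2 * m - e" a b a' "i * m"]] n l by simp
    next
      case False
      then obtain e where e: "d = 2 * e + 1" by (elim oddE)
      then have em: "1 \<le> e" "e < m" using d by simp_all
      then obtain n where n: "m = e + 1 + n" using le_Suc_ex[of "e + 1" m] by auto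
      have "(i + d) * m = i * m + (m - e) + e * (2 * m + 1)"
        "(i + d) * m + m = i * m + (2 * m - e) + e * (2 * m + 1)"
        by (simp_all add: e(1) n algebra_simps)
      then have "p ((i + d) * m) = p (i * m + (m - e))"
        "p ((i + d) * m + m) = p (i * m + (2 * m - e))" by (simp_all only: p_add)
      then show ?thesis unfolding col_def
        using cross[OF l(1,2) right_group[of "m - e" a b a' "i * m"] left_group[of "2 * m - e" a b b' "i * m"]] n em l by simp
    qed
  next
    fix i a b a' b' assume "a < a'" "b < b'" "a' < l" "b' < l"
    then show "col i a b \<noteq> col i a' b'" unfolding col_def
      by (intro cross right_later left_later) simp_all
  next
    fix i a b a' b' assume c: "col i a b = col (i + 1) a' b'" and l: "a < l" "b < l" "a' < l" "b' < l"
    have e: "(i + 1) * m = i * m + m" "i * m + m + m = i * m + 2 * m" by simp_all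
    show "b \<le> a'"
    proof (rule ccontr)
      assume "\<not> b \<le> a'"
      then have "colour {p (i * m) a, p (i * m + m) b} \<noteq> colour {p (i * m + m) a', p (i * m + 2 * m) b'}"
        using l m_pos by (intro cross right_earlier left_group) simp_all
      then show False using c[unfolded col_def e] by contradiction
    qed
  next
    fix i a b q assume c: "rad i q = col i a b" and l: "a < l" "b < l" "q < l"
    show "q \<le> a"
    proof (rule ccontr)
      assume "\<not> q \<le> a"
      then have "colour {p (i * m) a, p (i * m + m) b} \<noteq> colour {v0, p (i * m) q}"
        using l by (intro cross' right_later v0_left) simp_all
      then show False using c[unfolded col_def rad_def, symmetric] by contradiction
    qed
  next
    fix i a b q assume c: "rad (i + 1) q = col i a b" and l: "a < l" "b < l" "q < l"
    have e: "(i + 1) * m = i * m + m" by simp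
    show "b \<le> q"
    proof (rule ccontr)
      assume "\<not> b \<le> q"
      then have "colour {p (i * m) a, p (i * m + m) b} \<noteq> colour {v0, p (i * m + m) q}"
        using l by (intro cross' right_earlier v0_left) simp_all
      then show False using c[unfolded col_def rad_def e, symmetric] by contradiction
    qed
  next
    fix i a b q s assume s: "1 \<le> s" "s < m" and l: "a < l" "b < l" "q < l"
    obtain n where n: "m = s + 1 + n" using s le_Suc_ex[of "s + 1" m] by auto
    have "(i + 1 + 2 * s) * m = i * m + (m - s) + s * (2 * m + 1)" by (simp add: n algebra_simps)
    then have "p ((i + 1 + 2 * s) * m) = p (i * m + (m - s))" by (simp only: p_add)
    moreover have "colour {p (i * m) a, p (i * m + m) b} \<noteq> colour {v0, p (i * m + (m - s)) q}"
      using l s by (intro cross' right_group v0_left) simp_all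
    ultimately show "rad (i + 1 + 2 * s) q \<noteq> col i a b" unfolding col_def rad_def by simp
  qed (use assms m_pos fin in auto)
  show False by (rule no_star_colouring)
qed

end

section \<open>Regular polygons and small perturbations\<close>

lemma polygon_vertex_mod:
  assumes "k > 0"
  shows "polygon_vertex k c r \<theta> (i mod k) = polygon_vertex k c r \<theta> i"
proof -
  have "real i = real (i mod k) + real (i div k) * real k"
    by (metis of_nat_add of_nat_mult mod_mult_div_eq mult.commute)
  then have "\<theta> + 2 * pi * real i / real k
      = (\<theta> + 2 * pi * real (i mod k) / real k) + 2 * pi * of_nat (i div k)"
    using assms by (simp add: field_simps)
  moreover have "cis (x + 2 * pi * of_nat n) = cis x" for x n
    by (simp add: cis_mult[symmetric] cis_multiple_2pi)
  ultimately show ?thesis by (simp only: polygon_vertex_def)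
qed

text \<open>The value is \<open>r\<^sup>2\<close> times the sine of the central angle, which is
  below \<open>pi\<close> because \<open>2 * s < k\<close>.\<close>

lemma orient_centre_polygon_vertex:
  assumes "r > 0" "1 \<le> s" "2 * s < k"
  shows "orient c (polygon_vertex k c r \<theta> i) (polygon_vertex k c r \<theta> (i + s)) > 0"
proof -
  define \<alpha> where "\<alpha> = \<theta> + 2 * pi * real i / real k"
  define x where "x = 2 * pi * real s / real k"
  have *: "\<theta> + 2 * pi * real (i + s) / real k = \<alpha> + x"
    using assms by (simp add: \<alpha>_def x_def field_simps)
  have "orient c (polygon_vertex k c r \<theta> i) (polygon_vertex k c r \<theta> (i + s)) =
      r\<^sup>2 * (cos \<alpha> * sin (\<alpha> + x) - sin \<alpha> * cos (\<alpha> + x))"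
    by (simp only: orient_eq polygon_vertex_def * \<alpha>_def[symmetric])
      (simp add: power2_eq_square algebra_simps)
  also have "cos \<alpha> * sin (\<alpha> + x) - sin \<alpha> * cos (\<alpha> + x) = sin x"
    using sin_diff[of "\<alpha> + x" \<alpha>] by (simp add: algebra_simps)
  also have "0 < x" "x < pi"
  proof -
    show "0 < x" using assms by (simp add: x_def)
    have "real (2 * s) < real k" using assms(3) by (simp only: of_nat_less_iff)
    then show "x < pi" using assms by (simp add: x_def divide_simps)
  qed
  then have "r\<^sup>2 * sin x > 0" using assms(1) by (simp add: sin_gt_zero)
  finally show ?thesis .
qed

text \<open>With \<open>x\<close> and \<open>y\<close> half the central angles of the two arcs, the
  value is \<open>4 * r\<^sup>2 * sin x * sin y * sin (x + y)\<close>, and all three angles lie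
  strictly between 0 and \<open>pi\<close>.\<close>

lemma orient_polygon_vertices:
  assumes "r > 0" "1 \<le> s" "s < t" "t < k"
  shows "orient (polygon_vertex k c r \<theta> i) (polygon_vertex k c r \<theta> (i + s)) (polygon_vertex k c r \<theta> (i + t)) > 0"
proof -
  define \<alpha> where "\<alpha> = \<theta> + 2 * pi * real i / real k"
  define x where "x = pi * real s / real k"
  define y where "y = pi * real (t - s) / real k"
  have a1: "\<theta> + 2 * pi * real (i + s) / real k = \<alpha> + 2 * x"
    using assms by (simp add: \<alpha>_def x_def field_simps)
  have a2: "\<theta> + 2 * pi * real (i + t) / real k = \<alpha> + (2 * x + 2 * y)"
    using assms by (simp add: \<alpha>_def x_def y_def field_simps of_nat_diff)
  have "orient (polygon_vertex k c r \<theta> i) (polygon_vertex k c r \<theta> (i + s)) (polygon_vertex k c r \<theta> (i + t)) =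
      r\<^sup>2 * ((cos (\<alpha> + 2 * x) - cos \<alpha>) * (sin (\<alpha> + (2 * x + 2 * y)) - sin \<alpha>)
        - (sin (\<alpha> + 2 * x) - sin \<alpha>) * (cos (\<alpha> + (2 * x + 2 * y)) - cos \<alpha>))"
    by (simp only: orient_eq polygon_vertex_def \<alpha>_def[symmetric] a1 a2)
      (simp add: power2_eq_square algebra_simps)
  also have "(cos (\<alpha> + 2 * x) - cos \<alpha>) * (sin (\<alpha> + (2 * x + 2 * y)) - sin \<alpha>)
        - (sin (\<alpha> + 2 * x) - sin \<alpha>) * (cos (\<alpha> + (2 * x + 2 * y)) - cos \<alpha>)
      = sin (2 * y) + sin (2 * x) - sin (2 * x + 2 * y)"
  proof -
    have expand: "(c1 - c0) * (s2 - s0) - (s1 - s0) * (c2 - c0)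
        = (s2 * c1 - c2 * s1) + (s1 * c0 - c1 * s0) - (s2 * c0 - c2 * s0)" for c0 c1 c2 s0 s1 s2 :: real
      by (simp add: algebra_simps)
    show ?thesis unfolding expand sin_diff[symmetric] by simp
  qed
  also have "\<dots> = 4 * (sin x * sin y * sin (x + y))"
  proof -
    have "sin (2 * y) + sin (2 * x) = 2 * sin (x + y) * cos (x - y)"
      using sin_plus_sin[of "2 * x" "2 * y"]
      by (simp add: add_divide_distrib diff_divide_distrib add.commute)
    moreover have "sin (2 * x + 2 * y) = 2 * sin (x + y) * cos (x + y)"
      using sin_double[of "x + y"] by (simp add: distrib_left)
    moreover have "2 * sin (x + y) * cos (x - y) - 2 * sin (x + y) * cos (x + y)
        = 2 * sin (x + y) * (2 * sin x * sin y)"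
      unfolding right_diff_distrib[symmetric] by (simp add: cos_diff cos_add)
    ultimately show ?thesis by simp
  qed
  finally have eq: "orient (polygon_vertex k c r \<theta> i) (polygon_vertex k c r \<theta> (i + s)) (polygon_vertex k c r \<theta> (i + t)) =
      r\<^sup>2 * (4 * (sin x * sin y * sin (x + y)))" .
  have xy: "x + y = pi * real t / real k"
    using assms by (simp add: x_def y_def add_divide_distrib[symmetric] of_nat_diff algebra_simps)
  have sp: "sin (pi * real n / real k) > 0" if "0 < n" "n < k" for n
    using that by (intro sin_gt_zero) (auto simp: divide_simps)
  have "sin x > 0" "sin y > 0" "sin (x + y) > 0"
    unfolding xy unfolding x_def y_def by (rule sp; use assms in simp)+
  then show ?thesis unfolding eq using assms(1) by simp
qed

text \<open>Positive orientation is an open condition on the triple of points.\<close>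

lemma eventually_orient:
  assumes "orient a b c > 0"
  shows "\<forall>\<^sub>F \<epsilon> in at_right (0::real). \<forall>x\<in>ball a \<epsilon>. \<forall>y\<in>ball b \<epsilon>. \<forall>z\<in>ball c \<epsilon>. orient x y z > 0"
proof -
  let ?S = "{w :: complex \<times> complex \<times> complex. 0 < orient (fst w) (fst (snd w)) (snd (snd w))}"
  have "open ?S"
    unfolding orient_def by (intro open_Collect_less continuous_intros)
  moreover have "(a, b, c) \<in> ?S" using assms by simp
  ultimately obtain A B where A: "open A" "open B" "(a, b, c) \<in> A \<times> B" and AB: "A \<times> B \<subseteq> ?S"
    by (rule open_prod_elim)
  then have "(b, c) \<in> B" by simp
  with A(2) obtain B1 C1 where B: "open B1" "open C1" "(b, c) \<in> B1 \<times> C1" and BC: "B1 \<times> C1 \<subseteq> B"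
    by (rule open_prod_elim)
  have "a \<in> A" "b \<in> B1" "c \<in> C1" using A B by simp_all
  then obtain e1 e2 e3 where e: "e1 > 0" "ball a e1 \<subseteq> A" "e2 > 0" "ball b e2 \<subseteq> B1" "e3 > 0" "ball c e3 \<subseteq> C1"
    using A(1) B(1,2) by (meson openE)
  have "\<forall>x\<in>ball a \<epsilon>. \<forall>y\<in>ball b \<epsilon>. \<forall>z\<in>ball c \<epsilon>. orient x y z > 0" if "\<epsilon> < min e1 (min e2 e3)" for \<epsilon>
  proof (intro ballI)
    fix x y z assume "x \<in> ball a \<epsilon>" "y \<in> ball b \<epsilon>" "z \<in> ball c \<epsilon>"
    then have "x \<in> ball a e1" "y \<in> ball b e2" "z \<in> ball c e3" using that by simp_all
    then have "x \<in> A" "y \<in> B1" "z \<in> C1" using e by blast+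
    then have "(x, y, z) \<in> ?S" using AB BC by blast
    then show "orient x y z > 0" by simp
  qed
  moreover have "\<forall>\<^sub>F \<epsilon> in at_right 0. \<epsilon> < min e1 (min e2 e3)"
    using e by (intro order_tendstoD(2)[OF tendsto_ident_at]) simp
  ultimately show ?thesis by (elim eventually_mono) blast
qed

lemma enumerate_by_key:
  fixes \<kappa> :: "'a \<Rightarrow> real"
  assumes "finite A" "inj_on \<kappa> A"
  obtains q where "\<And>a. a < card A \<Longrightarrow> q a \<in> A" "\<And>a b. a < b \<Longrightarrow> b < card A \<Longrightarrow> \<kappa> (q a) < \<kappa> (q b)"
proof -
  let ?xs = "sorted_list_of_set (\<kappa> ` A)"
  have len: "length ?xs = card A" using assms by (simp add: card_image)
  have in_A: "?xs ! a \<in> \<kappa> ` A" if "a < card A" for a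
    using that assms len nth_mem[of a ?xs] by simp
  define q where "q a = inv_into A \<kappa> (?xs ! a)" for a
  have "q a \<in> A" "\<kappa> (q a) = ?xs ! a" if "a < card A" for a
    using in_A[OF that] by (simp_all add: q_def inv_into_into f_inv_into_f)
  moreover have "?xs ! a < ?xs ! b" if "a < b" "b < card A" for a b
    using that len sorted_wrt_nth_less[OF strict_sorted_list_of_set[of "\<kappa> ` A"]] by simp
  ultimately show ?thesis using that[of q] by simp
qed

text \<open>Turned by \<open>- \<alpha>\<close> about \<open>c\<close>, the group lies in the right
  half-plane since \<open>\<epsilon> \<le> r\<close>. There the angular order is that of the slopes
  \<open>\<kappa>\<close>, which general position makes distinct.\<close>

lemma order_around_centre:
  assumes "finite A" and A: "A \<subseteq> ball (c + of_real r * cis \<alpha>) \<epsilon>" and "\<epsilon> \<le> r"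
    and gen: "general_position V" "insert c A \<subseteq> V"
  obtains q where "\<And>a. a < card A \<Longrightarrow> q a \<in> A"
    "\<And>a b. a < b \<Longrightarrow> b < card A \<Longrightarrow> orient c (q a) (q b) > 0"
proof -
  define w where "w z = (z - c) * cis (- \<alpha>)" for z
  define \<kappa> where "\<kappa> z = Im (w z) / Re (w z)" for z
  have pos: "Re (w z) > 0" if "z \<in> A" for z
  proof -
    have "cmod (z - (c + of_real r * cis \<alpha>)) < r" using that A assms(3) by (auto simp: dist_norm norm_minus_commute)
    moreover have "w z - of_real r = (z - (c + of_real r * cis \<alpha>)) * cis (- \<alpha>)"
      by (simp add: w_def algebra_simps cis_mult)
    ultimately have "cmod (w z - of_real r) < r" by (simp add: norm_mult)
    then have "\<bar>Re (w z - of_real r)\<bar> < r" using abs_Re_le_cmod le_less_trans by blast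
    then show ?thesis by simp
  qed
  have or: "orient c z z' = Re (w z) * Re (w z') * (\<kappa> z' - \<kappa> z)" if "z \<in> A" "z' \<in> A" for z z'
  proof -
    have "cnj (w z) * w z' = cnj (z - c) * (z' - c) * (cis \<alpha> * cis (- \<alpha>))"
      by (simp add: w_def cis_cnj algebra_simps)
    then have "orient c z z' = Im (cnj (w z) * w z')" by (simp add: orient_def cis_mult)
    also have "\<dots> = Re (w z) * Re (w z') * (\<kappa> z' - \<kappa> z)"
      using pos[OF that(1)] pos[OF that(2)] by (simp add: \<kappa>_def field_simps)
    finally show ?thesis .
  qed
  have "inj_on \<kappa> A"
  proof (rule inj_onI, rule ccontr)
    fix z z' assume z: "z \<in> A" "z' \<in> A" "\<kappa> z = \<kappa> z'" "z \<noteq> z'"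
    have ne: "c \<noteq> z" "c \<noteq> z'" using pos[OF z(1)] pos[OF z(2)] by (auto simp: w_def)
    have "orient c z z' = 0" using or[OF z(1,2)] z(3) by simp
    then obtain s where "z' = (1 - s) *\<^sub>R c + s *\<^sub>R z" using ne(1) by (rule orient_zero_on_line)
    then have "collinear {c, z', z}" unfolding collinear_3_expand by (intro disjI2 exI[of _ "1 - s"]) simp
    moreover have "card {c, z', z} = 3" using ne z by simp
    moreover have "{c, z', z} \<subseteq> V" using gen(2) z by auto
    ultimately show False using gen(1) unfolding general_position_def by blast
  qed
  then obtain q where q: "\<And>a. a < card A \<Longrightarrow> q a \<in> A" "\<And>a b. a < b \<Longrightarrow> b < card A \<Longrightarrow> \<kappa> (q a) < \<kappa> (q b)"
    by (rule enumerate_by_key[OF \<open>finite A\<close>]) blast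
  have "orient c (q a) (q b) > 0" if "a < b" "b < card A" for a b
    using or[OF q(1) q(1), of a b] pos[OF q(1)] q(2)[OF that] that by simp
  then show ?thesis using that q(1) by blast
qed

theorem theorem19:
  fixes k l :: nat and v\<^sub>0 :: complex and r \<theta> :: real
  assumes "odd k" and "k \<ge> 3"
    and "odd l" and "l > 5"
    and "r > 0"
  shows "\<forall>\<^sub>F \<epsilon> in at_right 0. \<forall>G. bumpy_wheel k l v\<^sub>0 r \<theta> \<epsilon> G \<longrightarrow>
           \<not> (\<exists>P. graph_partition P G \<and> card P = (k * l + 1) div 2 \<and> (\<forall>H\<in>P. plane_graph H))"
proof -
  let ?v = "polygon_vertex k v\<^sub>0 r \<theta>"
  let ?near = "\<lambda>\<epsilon> a b c. \<forall>x\<in>ball a \<epsilon>. \<forall>y\<in>ball b \<epsilon>. \<forall>z\<in>ball c \<epsilon>. orient x y z > 0"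
  obtain m where m: "k = 2 * m + 1" using \<open>odd k\<close> by (elim oddE)
  have k0: "k > 0" and m1: "1 \<le> m" using m \<open>k \<ge> 3\<close> by simp_all
  have ev_near: "\<forall>\<^sub>F \<epsilon> in at_right 0. orient a b c > 0 \<longrightarrow> ?near \<epsilon> a b c" for a b c
    using eventually_orient[of a b c] by (cases "orient a b c > 0") simp_all
  \<comment> \<open>Only finitely many triples are involved, so one threshold for
    \<open>\<epsilon>\<close> preserves all their positive orientations.\<close>
  have "\<forall>\<^sub>F \<epsilon> in at_right 0. \<forall>i\<in>{..<k}. \<forall>j\<in>{..<k}. orient v\<^sub>0 (?v i) (?v j) > 0 \<longrightarrow> ?near \<epsilon> v\<^sub>0 (?v i) (?v j)"
    by (intro eventually_ball_finite ballI finite_lessThan ev_near)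
  moreover have "\<forall>\<^sub>F \<epsilon> in at_right 0. \<forall>i\<in>{..<k}. \<forall>j\<in>{..<k}. \<forall>h\<in>{..<k}.
      orient (?v i) (?v j) (?v h) > 0 \<longrightarrow> ?near \<epsilon> (?v i) (?v j) (?v h)"
    by (intro eventually_ball_finite ballI finite_lessThan ev_near)
  moreover have "\<forall>\<^sub>F \<epsilon> in at_right 0. \<epsilon> < r"
    using \<open>r > 0\<close> by (intro order_tendstoD(2)[OF tendsto_ident_at])
  moreover have "\<forall>\<^sub>F \<epsilon> in at_right (0::real). 0 < \<epsilon>" by (rule eventually_at_right_less)
  ultimately show ?thesis
  proof eventually_elim
    case (elim \<epsilon>)
    show ?case
    proof (intro allI impI notI)
      fix G assume "bumpy_wheel k l v\<^sub>0 r \<theta> \<epsilon> G"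
        and "\<exists>P. graph_partition P G \<and> card P = (k * l + 1) div 2 \<and> (\<forall>H\<in>P. plane_graph H)"
      then obtain A P where A: "\<And>i. i < k \<Longrightarrow> card (A i) = l" "\<And>i. i < k \<Longrightarrow> A i \<subseteq> ball (?v i) \<epsilon>"
        and ext: "\<And>x. x \<in> (\<Union>i<k. A i) \<Longrightarrow> x extreme_point_of (convex hull (insert v\<^sub>0 (\<Union>i<k. A i)))"
        and G: "G = complete_graph (insert v\<^sub>0 (\<Union>i<k. A i))" "geometric_graph G"
        and P: "graph_partition P G" "card P = (k * l + 1) div 2" "\<And>H. H \<in> P \<Longrightarrow> plane_graph H"
        unfolding bumpy_wheel_def Let_def by metis
      define V where "V = insert v\<^sub>0 (\<Union>i<k. A i)"
      have gen: "general_position V"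
        using G by (simp add: geometric_graph_def complete_graph_def V_def)
      have fin: "finite (A i)" if "i < k" for i
        using A(1)[OF that] \<open>l > 5\<close> by (intro card_ge_0_finite) simp
      have "\<exists>q. (\<forall>a<l. q a \<in> A i) \<and> (\<forall>a b. a < b \<longrightarrow> b < l \<longrightarrow> orient v\<^sub>0 (q a) (q b) > 0)" if i: "i < k" for i
      proof -
        have sub: "insert v\<^sub>0 (A i) \<subseteq> V" using i by (auto simp: V_def)
        obtain q where "\<And>a. a < card (A i) \<Longrightarrow> q a \<in> A i"
          "\<And>a b. a < b \<Longrightarrow> b < card (A i) \<Longrightarrow> orient v\<^sub>0 (q a) (q b) > 0"
          by (rule order_around_centre[OF fin[OF i] A(2)[OF i, unfolded polygon_vertex_def] less_imp_le[OF elim(3)] gen sub]) blast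
        then show ?thesis using A(1)[OF i] by auto
      qed
      then obtain q where q: "\<And>i a. i < k \<Longrightarrow> a < l \<Longrightarrow> q i a \<in> A i"
        "\<And>i a b. i < k \<Longrightarrow> a < b \<Longrightarrow> b < l \<Longrightarrow> orient v\<^sub>0 (q i a) (q i b) > 0"
        by metis
      define p where "p g = q (g mod k)" for g
      have pA: "p g a \<in> A (g mod k)" if "a < l" for g a using q(1) that k0 by (simp add: p_def)
      then have pW: "p g a \<in> (\<Union>i<k. A i)" if "a < l" for g a using that k0 by fastforce
      have pb: "p g a \<in> ball (?v (g mod k)) \<epsilon>" if "a < l" for g a
        using pA[OF that, of g] A(2)[of "g mod k"] k0 by auto
      note vm = polygon_vertex_mod[OF k0, of v\<^sub>0 r \<theta>]
      interpret wheel m l v\<^sub>0 p V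
      proof
        show "1 \<le> m" by (rule m1)
        show "v\<^sub>0 \<in> V" by (simp add: V_def)
        show "p g a \<in> V" if "a < l" for g a using pW[OF that] by (simp add: V_def)
        show "p g a extreme_point_of convex hull V" if "a < l" for g a
          unfolding V_def by (rule ext[OF pW[OF that]])
        show "p (g + (2 * m + 1)) = p g" for g unfolding p_def m[symmetric] by simp
        show "orient v\<^sub>0 (p g a) (p g b) > 0" if "a < b" "b < l" for g a b
          unfolding p_def using q(2) that k0 by simp
        show "orient v\<^sub>0 (p g a) (p (g + s) b) > 0" if "1 \<le> s" "s \<le> m" "a < l" "b < l" for g s a b
        proof -
          have "orient v\<^sub>0 (?v (g mod k)) (?v ((g + s) mod k)) > 0"
            unfolding vm using that m \<open>r > 0\<close> by (intro orient_centre_polygon_vertex) simp_all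
          then have "?near \<epsilon> v\<^sub>0 (?v (g mod k)) (?v ((g + s) mod k))"
            by (intro elim(1)[THEN bspec, THEN bspec, THEN mp]) (use k0 in simp_all)
          then show ?thesis using pb that elim(4) centre_in_ball by blast
        qed
        show "orient (p g a) (p (g + s) b) (p (g + t) c) > 0"
          if "1 \<le> s" "s < t" "t \<le> 2 * m" "a < l" "b < l" "c < l" for g s t a b c
        proof -
          have "orient (?v (g mod k)) (?v ((g + s) mod k)) (?v ((g + t) mod k)) > 0"
            unfolding vm using that m \<open>r > 0\<close> by (intro orient_polygon_vertices) simp_all
          then have "?near \<epsilon> (?v (g mod k)) (?v ((g + s) mod k)) (?v ((g + t) mod k))"
            by (intro elim(2)[THEN bspec, THEN bspec, THEN bspec, THEN mp]) (use k0 in simp_all)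
          then show ?thesis using pb that by blast
        qed
      qed
      \<comment> \<open>\<open>k * l\<close> is odd, so the division by 2 is exact.\<close>
      have "2 * card P = (2 * m + 1) * l + 1"
        unfolding P(2) m[symmetric] using \<open>odd k\<close> \<open>odd l\<close> by simp
      then show False
        using no_plane_partition[OF \<open>l > 5\<close>] P(1,3) G(1) unfolding V_def by blast
    qed
  qed
qed

end
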